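(* Let $f:K_{4}\to\mathbb{R}^{2}$ be a plane generic immersion of the complete graph $K_4$ on $4$ vertices. Then \[ \sum_{\gamma\in\Gamma(K_{4})}\mathrm{rot}(f(\gamma))\equiv 1\pmod 2, \] where $\Gamma(K_4)$ is the set of all cycles of $K_4$.
   Context: A finite graph $G$ is regarded as a topological space in the usual way. A cycle of $G$ is a subgraph homeomorphic to a circle. A plane generic immersion of $G$ is an immersion $f:G\to\mathbb{R}^2$ (a continuous locally injective, piecewise smooth map) whose multiple points are only finitely many transversal double points between edges, i.e. between interior points of edges (possibly of the same edge). Each cycle $\gamma$ is given an arbitrary orientation, and $\mathrm{rot}(f(\gamma))$ is the rotation number (turning number) of the oriented immersed closed plane curve $f(\gamma)$, corners at vertices being smoothed; equivalently, parametrizing $f|_\gamma$ by $c:\mathbb{R}/\mathbb{Z}\to\mathbb{R}^2$, it is the degree of $t\mapsto (c(t+\epsilon)-c(t))/\|c(t+\epsilon)-c(t)\|$ for small $\epsilon>0$. Its parity does not depend on the orientation. *)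

theory Defs
  imports "HOL-Complex_Analysis.Complex_Analysis" "HOL-Number_Theory.Cong"
begin

text \<open>
  Finite simple graphs are pairs (vertices, edges), an edge being a two-element set of vertices.
  As a topological space a graph is realised with its vertices at the standard basis vectors of
  Euclidean space and its edges as straight segments, i.e. as a subcomplex of the 1-skeleton of
  the standard simplex. The target plane is \<^typ>\<open>complex\<close>, so that the library's
  \<^const>\<open>winding_number\<close> can be used.
\<close>

type_synonym 'v fin_graph = "'v set \<times> 'v set set"

definition complete_graph :: "'v fin_graph" where
  "complete_graph = (UNIV, {e. card e = 2})"

definition is_subgraph :: "'v fin_graph \<Rightarrow> 'v fin_graph \<Rightarrow> bool" where
  "is_subgraph H G \<longleftrightarrow>
     fst H \<subseteq> fst G \<and> snd H \<subseteq> snd G \<and> (\<forall>e\<in>snd H. e \<subseteq> fst H)"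

definition vertex_point :: "'v \<Rightarrow> real ^ 'v::finite" where
  "vertex_point v = axis v 1"

definition edge_path :: "'v \<Rightarrow> 'v \<Rightarrow> real \<Rightarrow> real ^ 'v::finite" where
  "edge_path u v = linepath (vertex_point u) (vertex_point v)"

definition graph_space :: "'v::finite fin_graph \<Rightarrow> (real ^ 'v) set" where
  "graph_space G = vertex_point ` fst G \<union> (\<Union>e\<in>snd G. convex hull (vertex_point ` e))"

definition cycles :: "'v::finite fin_graph \<Rightarrow> 'v fin_graph set" where
  "cycles G = {H. is_subgraph H G \<and> graph_space H homeomorphic sphere (0::complex) 1}"

text \<open>
  An immersion is continuous, locally injective and piecewise smooth. Nothing is required of the
  derivatives at the finitely many break points of an edge, nor are the derivatives required to
  be nonzero.
\<close>

definition immersion :: "'v::finite fin_graph \<Rightarrow> (real ^ 'v \<Rightarrow> complex) \<Rightarrow> bool" where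
  "immersion G f \<longleftrightarrow>
     continuous_on (graph_space G) f \<and>
     (\<forall>x\<in>graph_space G. \<exists>U. open U \<and> x \<in> U \<and> inj_on f (graph_space G \<inter> U)) \<and>
     (\<forall>u v. {u, v} \<in> snd G \<longrightarrow> (f \<circ> edge_path u v) piecewise_C1_differentiable_on {0..1})"

definition multiple_values :: "'v::finite fin_graph \<Rightarrow> (real ^ 'v \<Rightarrow> complex) \<Rightarrow> complex set" where
  "multiple_values G f =
     {y. \<exists>x\<in>graph_space G. \<exists>x'\<in>graph_space G. x \<noteq> x' \<and> f x = y \<and> f x' = y}"

text \<open>
  The value \<open>y\<close> is attained exactly twice, at two distinct interior points of (possibly equal)
  edges, and the tangent vectors there span the plane.
\<close>

definition transversal_double_point ::
    "'v::finite fin_graph \<Rightarrow> (real ^ 'v \<Rightarrow> complex) \<Rightarrow> complex \<Rightarrow> bool" where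
  "transversal_double_point G f y \<longleftrightarrow>
     (\<exists>u v s u' v' s' d d'.
        {u, v} \<in> snd G \<and> {u', v'} \<in> snd G \<and> 0 < s \<and> s < 1 \<and> 0 < s' \<and> s' < 1 \<and>
        edge_path u v s \<noteq> edge_path u' v' s' \<and>
        {x \<in> graph_space G. f x = y} = {edge_path u v s, edge_path u' v' s'} \<and>
        ((f \<circ> edge_path u v) has_vector_derivative d) (at s) \<and>
        ((f \<circ> edge_path u' v') has_vector_derivative d') (at s') \<and>
        span {d, d'} = UNIV)"

definition plane_generic_immersion ::
    "'v::finite fin_graph \<Rightarrow> (real ^ 'v \<Rightarrow> complex) \<Rightarrow> bool" where
  "plane_generic_immersion G f \<longleftrightarrow>
     immersion G f \<and> finite (multiple_values G f) \<and>
     (\<forall>y\<in>multiple_values G f. transversal_double_point G f y)"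

text \<open>
  A parametrisation of a cycle by \<open>[0,1]\<close> with the end points identified; it determines an
  orientation, and both orientations arise in this way.
\<close>

definition parametrizes :: "(real \<Rightarrow> real ^ 'v) \<Rightarrow> 'v::finite fin_graph \<Rightarrow> bool" where
  "parametrizes p H \<longleftrightarrow>
     simple_path p \<and> pathfinish p = pathstart p \<and> path_image p = graph_space H"

text \<open>
  A loop \<open>g\<close> on \<open>[0,1]\<close> is extended 1-periodically by \<^const>\<open>frac\<close>. The degree of a map from the
  circle to the unit circle is its winding number around 0, and \<open>sgn z = z / \<bar>z\<bar>\<close>.
\<close>

definition rotation_number :: "(real \<Rightarrow> complex) \<Rightarrow> int" where
  "rotation_number g =
     (let c = (\<lambda>t. g (frac t)) in
      THE n. \<forall>\<^sub>F \<epsilon> in at_right 0.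
        winding_number (\<lambda>t. sgn (c (t + \<epsilon>) - c t)) 0 = of_int n)"

end

theory Submission
  imports Defs
begin

text \<open>
  Write \<open>h(x, y) = f(y) - f(x)\<close> and let a turn be the total change of the argument of \<open>h\<close> along a
  path of pairs \<open>(x, y)\<close>, measured in revolutions. The rotation number of a cycle is the turn of a
  short secant running once around it: it splits into turns along the edges and turns around the
  corners. Around the boundary of the (truncated) cell of pairs of points belonging to a given pair
  of edges, the turns add up to an integer, the defect of the pair of edges, which counts the double
  points between these edges modulo 2. Expressing the edge turns and corner turns by defects and by
  the turns of an edge seen from a vertex, the contributions of incident vertices cancel around the
  cycle, and the remaining ones add up to twice the turn of some path from \<open>z\<close> to \<open>-z\<close>, that is to an
  odd integer. So the rotation number of a cycle is 1 plus the sum of its defects modulo 2. In \<open>K\<^sub>4\<close> a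
  single edge lies on four cycles, a pair of edges on two, so the defects cancel in the sum
  over the seven cycles, leaving 7.
\<close>

section \<open>Turning of a nowhere vanishing plane curve\<close>

text \<open>An immersed edge may have points without a nonzero derivative, so secants over a
  parameter lag \<eta> take the place of tangents. One \<eta> serves all cycles of the graph; hence
  a given edge or corner contributes the same term, up to orientation, to every cycle through it.
  The cells have to be truncated because \<open>h\<close> vanishes where the two points of a pair
  coincide: within one edge only pairs at parameter distance at least \<eta> are kept, and for two
  edges with a common vertex the corner of the square at that vertex is cut off. These cuts are
  precisely where the short secant of a cycle runs. On the boundary of the cells \<open>h\<close> is
  nonzero, while inside it may vanish; this is how a defect can be nonzero. The defects are never
  evaluated: the argument rests on their being integers and on a change of orientation altering at
  most their sign, which is invisible modulo 2.\<close>

definition turn :: "(real \<Rightarrow> complex) \<Rightarrow> real \<Rightarrow> real \<Rightarrow> complex" where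
  "turn u x y = winding_number (\<lambda>t. sgn (u (x + (y - x) * t))) 0"

lemma turn_cong:
  assumes "\<And>t. x \<le> t \<Longrightarrow> t \<le> y \<Longrightarrow> u t = v t" and "x \<le> y"
  shows "turn u x y = turn v x y"
  unfolding turn_def
proof (rule winding_number_cong)
  fix t :: real assume "0 \<le> t" "t \<le> 1"
  then have "0 \<le> (y - x) * t" "(y - x) * t \<le> y - x"
    using assms(2) by (auto simp: mult_left_le)
  then show "sgn (u (x + (y - x) * t)) = sgn (v (x + (y - x) * t))"
    using assms(1)[of "x + (y - x) * t"] by auto
qed

lemma turn_shift: "turn (\<lambda>t. u (t + c)) x y = turn u (x + c) (y + c)"
  by (simp add: turn_def algebra_simps)

context
  fixes u :: "real \<Rightarrow> complex" and x y :: real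
  assumes xy: "x \<le> y" and cont: "continuous_on {x..y} u"
    and nz: "\<And>t. x \<le> t \<Longrightarrow> t \<le> y \<Longrightarrow> u t \<noteq> 0"
begin

lemma turn_range: "0 \<le> t \<Longrightarrow> t \<le> 1 \<Longrightarrow> x \<le> x + (y - x) * t \<and> x + (y - x) * t \<le> y"
  using xy mult_left_le[of t "y - x"] by (auto simp: mult.commute)

lemma turn_path: "path (\<lambda>t. sgn (u (x + (y - x) * t)))"
  unfolding path_def
  by (intro continuous_on_sgn continuous_on_compose2[OF cont] continuous_intros)
     (use turn_range nz in auto)

lemma turn_avoids: "0 \<notin> path_image (\<lambda>t. sgn (u (x + (y - x) * t)))"
  using nz turn_range by (fastforce simp: path_image_def sgn_zero_iff)

text \<open>The values of \<open>sgn\<close> have modulus 1, so the winding number of the open path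
  carries no contribution from a changing modulus; up to an integer it is determined by the two end
  directions. All integrality arguments below rest on this.\<close>

lemma exp_turn: "exp (2 * of_real pi * \<i> * turn u x y) = sgn (u y) / sgn (u x)"
  using winding_number_exp_2pi[OF turn_path turn_avoids] nz[of x] xy
  by (simp add: pathfinish_def pathstart_def turn_def sgn_zero_iff field_simps)

lemma turn_add:
  assumes "x \<le> m" "m \<le> y"
  shows "turn u x m + turn u m y = turn u x y"
proof (cases "x = y")
  case True
  then show ?thesis
    using winding_number_constI[of "sgn (u x)" 0] nz assms
    by (simp add: turn_def sgn_zero_iff)
next
  case False
  then have "x < y" using xy by simp
  define r where "r = (m - x) / (y - x)"
  have r: "r \<in> {0..1}" "(y - x) * r = m - x"
    using assms \<open>x < y\<close> by (auto simp: r_def field_simps)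
  define g where "g = (\<lambda>t. sgn (u (x + (y - x) * t)))"
  have "winding_number (subpath 0 r g) 0 + winding_number (subpath r 1 g) 0
      = winding_number (subpath 0 1 g) 0"
    using turn_path turn_avoids r unfolding g_def by (intro winding_number_subpath_combine) auto
  moreover have "subpath 0 r g = (\<lambda>t. sgn (u (x + (m - x) * t)))"
    using r(2) by (simp add: subpath_def g_def fun_eq_iff mult.assoc[symmetric])
  moreover have "subpath r 1 g = (\<lambda>t. sgn (u (m + (y - m) * t)))"
  proof
    fix t
    have "x + (y - x) * ((1 - r) * t + r) = x + ((y - x) - (y - x) * r) * t + (y - x) * r"
      by (simp add: algebra_simps)
    also have "\<dots> = m + (y - m) * t" unfolding r(2) by (simp add: algebra_simps)
    finally show "subpath r 1 g t = sgn (u (m + (y - m) * t))"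
      by (simp add: subpath_def g_def)
  qed
  ultimately show ?thesis by (simp add: turn_def g_def)
qed

text \<open>The sign shifts a continuous logarithm by the constant \<open>\<i> * pi\<close>, and
  only the difference of its end values counts. Hence the two points of a pair may be exchanged
  without changing a turn.\<close>

lemma turn_uminus: "turn (\<lambda>t. - u t) x y = turn u x y"
proof -
  obtain q where q: "path q" "pathfinish q - pathstart q = 2 * of_real pi * \<i> * turn u x y"
    "\<And>t. t \<in> {0..1} \<Longrightarrow> sgn (u (x + (y - x) * t)) = 0 + exp (q t)"
    using winding_number_as_continuous_log[OF turn_path turn_avoids] unfolding turn_def by metis
  let ?q = "\<lambda>t. q t + \<i> * pi"
  have "turn (\<lambda>t. - u t) x y = winding_number (exp \<circ> ?q) 0"
    unfolding turn_def by (rule winding_number_cong) (use q(3) in \<open>auto simp: exp_add sgn_minus\<close>)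
  also have "\<dots> = (pathfinish ?q - pathstart ?q) / (2 * of_real pi * \<i>)"
    using q(1) by (intro winding_number_compose_exp) (auto simp: path_def intro!: continuous_intros)
  also have "\<dots> = turn u x y" using q(2) by (simp add: pathfinish_def pathstart_def)
  finally show ?thesis .
qed

lemma turn_reverse: "turn (\<lambda>t. u (c - t)) (c - y) (c - x) = - turn u x y"
proof -
  have "turn (\<lambda>t. u (c - t)) (c - y) (c - x) = winding_number (reversepath (\<lambda>t. sgn (u (x + (y - x) * t)))) 0"
    by (simp add: turn_def reversepath_def algebra_simps)
  then show ?thesis using winding_number_reversepath[OF turn_path turn_avoids] by (simp add: turn_def)
qed

end

text \<open>Reversing an edge exchanges the end points of its secants and also reverses time. The
  exchange has no effect, the reversal gives the sign.\<close>

lemma turn_uminus_reverse: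
  assumes "x \<le> y" "continuous_on {x..y} u" "\<And>t. x \<le> t \<Longrightarrow> t \<le> y \<Longrightarrow> u t \<noteq> 0"
  shows "turn (\<lambda>t. - u (c - t)) (c - y) (c - x) = - turn u x y"
proof -
  have "turn (\<lambda>t. - u (c - t)) (c - y) (c - x) = - turn (\<lambda>t. - u t) x y"
    by (rule turn_reverse) (use assms in \<open>auto intro: continuous_on_minus\<close>)
  then show ?thesis by (simp add: turn_uminus[OF assms])
qed

section \<open>Turns and defects of an immersed complete graph\<close>

lemma exp_eq_1_imp_int:
  assumes "exp (2 * of_real pi * \<i> * z) = 1"
  obtains n where "z = of_int n"
proof -
  obtain n :: int where "Re (2 * of_real pi * \<i> * z) = 0" "Im (2 * of_real pi * \<i> * z) = of_int (2 * n) * pi"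
    using assms unfolding exp_eq_1 by blast
  then have "z = of_int n" by (auto simp: complex_eq_iff)
  with that show thesis .
qed

text \<open>A path from a direction to the opposite one makes half an odd number of revolutions.
  This is the source of the odd integer in every rotation number below.\<close>

lemma exp_eq_minus_1_imp_odd:
  assumes "exp (2 * of_real pi * \<i> * z) = -1"
  obtains n where "2 * z = of_int (2 * n + 1)"
proof -
  have "exp (2 * of_real pi * \<i> * (z - 1/2)) = 1"
    using assms by (simp add: right_diff_distrib exp_diff)
  then obtain n where "z - 1/2 = of_int n" by (rule exp_eq_1_imp_int)
  then have "2 * z = of_int (2 * n + 1)" by (simp add: field_simps)
  with that show thesis .
qed

lemma sgn_diff_commute: "sgn (x - y) = - sgn (y - x)" for x y :: "'a::real_normed_vector"
  by (metis minus_diff_eq sgn_minus)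

text \<open>The last four assumptions state that \<open>h\<close> does not vanish on the boundaries
  of the truncated cells: \<open>end_ne\<close> and \<open>opp_ne\<close> on the sides where one
  point is a vertex, \<open>edge_ne\<close> and \<open>corner_ne\<close> on the cuts. The lag \<eta>
  is a parameter because the same map is later considered with different lags.\<close>

locale immersed_complete_graph =
  fixes F :: "'v \<Rightarrow> 'v \<Rightarrow> real \<Rightarrow> complex" and X :: "'v \<Rightarrow> complex" and \<eta> :: real
  assumes eta: "0 < \<eta>" "\<eta> < 1"
    and F_0: "F a b 0 = X a"
    and F_rev: "F b a t = F a b (1 - t)"
    and cont: "continuous_on {0..1} (F a b)"
    and end_ne: "a \<noteq> b \<Longrightarrow> 0 < t \<Longrightarrow> t \<le> 1 \<Longrightarrow> F a b t \<noteq> X a"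
    and opp_ne: "distinct [a, b, c] \<Longrightarrow> 0 \<le> t \<Longrightarrow> t \<le> 1 \<Longrightarrow> F a b t \<noteq> X c"
    and edge_ne: "a \<noteq> b \<Longrightarrow> 0 \<le> t \<Longrightarrow> t + \<eta> \<le> 1 \<Longrightarrow> F a b (t + \<eta>) \<noteq> F a b t"
    and corner_ne: "distinct [a, b, c] \<Longrightarrow> 0 \<le> t \<Longrightarrow> t \<le> \<eta> \<Longrightarrow> F b c t \<noteq> F a b (1 - \<eta> + t)"
begin

lemma F_1: "F a b 1 = X b"
  using F_rev[of a b 1] F_0[of b a] by simp

lemma end_ne': "a \<noteq> b \<Longrightarrow> 0 \<le> t \<Longrightarrow> t < 1 \<Longrightarrow> F a b t \<noteq> X b"
  using F_rev[of a b t] end_ne[of b a "1 - t"] by simp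

lemma X_ne: "a \<noteq> b \<Longrightarrow> X a \<noteq> X b"
  using end_ne[of a b 1] by (simp add: F_1)

definition edge_turn :: "'v \<Rightarrow> 'v \<Rightarrow> complex" where
  "edge_turn a b = turn (\<lambda>t. F a b (t + \<eta>) - F a b t) 0 (1 - \<eta>)"

definition corner_turn :: "'v \<Rightarrow> 'v \<Rightarrow> 'v \<Rightarrow> complex" where
  "corner_turn a b c = turn (\<lambda>t. F b c t - F a b (1 - \<eta> + t)) 0 \<eta>"

text \<open>The viewpoint \<open>X a\<close> is the start of the edge itself, where the difference
  vanishes; so the parameter begins at \<eta>, a corner of the truncated cell. For the same reason
  \<open>end_turn\<close> stops at \<open>1 - \<eta>\<close>.\<close>

definition start_turn :: "'v \<Rightarrow> 'v \<Rightarrow> complex" where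
  "start_turn a b = turn (\<lambda>t. F a b t - X a) \<eta> 1"

definition end_turn :: "'v \<Rightarrow> 'v \<Rightarrow> complex" where
  "end_turn a b = turn (\<lambda>t. F a b t - X b) 0 (1 - \<eta>)"

definition view_turn :: "'v \<Rightarrow> 'v \<Rightarrow> 'v \<Rightarrow> complex" where
  "view_turn c a b = turn (\<lambda>t. F a b t - X c) 0 1"

lemma cont_F [continuous_intros]:
  assumes "continuous_on S h" "\<And>t. t \<in> S \<Longrightarrow> h t \<in> {0..1}"
  shows "continuous_on S (\<lambda>t. F a b (h t))"
  using continuous_on_compose2[OF cont assms(1)] assms(2) by blast

lemma exp_edge_turn:
  assumes "a \<noteq> b"
  shows "exp (2 * of_real pi * \<i> * edge_turn a b) = sgn (X b - F a b (1 - \<eta>)) / sgn (F a b \<eta> - X a)"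
  unfolding edge_turn_def using eta assms edge_ne[OF assms]
  by (subst exp_turn) (auto intro!: continuous_intros simp: F_0 F_1)

lemma exp_corner_turn:
  assumes "distinct [a, b, c]"
  shows "exp (2 * of_real pi * \<i> * corner_turn a b c) = sgn (F b c \<eta> - X b) / sgn (X b - F a b (1 - \<eta>))"
  unfolding corner_turn_def using eta assms corner_ne[OF assms]
  by (subst exp_turn) (auto intro!: continuous_intros simp: F_0 F_1)

lemma exp_start_turn:
  assumes "a \<noteq> b"
  shows "exp (2 * of_real pi * \<i> * start_turn a b) = sgn (X b - X a) / sgn (F a b \<eta> - X a)"
  unfolding start_turn_def using eta assms end_ne[OF assms]
  by (subst exp_turn) (auto intro!: continuous_intros simp: F_0 F_1)

lemma exp_end_turn:
  assumes "a \<noteq> b"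
  shows "exp (2 * of_real pi * \<i> * end_turn a b) = sgn (X b - F a b (1 - \<eta>)) / sgn (X b - X a)"
  unfolding end_turn_def using eta assms end_ne'[OF assms]
  by (subst exp_turn)
     (auto intro!: continuous_intros simp: F_0 F_1 sgn_diff_commute[of _ "X b"])

lemma exp_view_turn:
  assumes "distinct [a, b, c]"
  shows "exp (2 * of_real pi * \<i> * view_turn c a b) = sgn (X b - X c) / sgn (X a - X c)"
  unfolding view_turn_def using eta assms opp_ne[OF assms]
  by (subst exp_turn) (auto intro!: continuous_intros simp: F_0 F_1)

section \<open>Behaviour of the turns under reversal of orientation\<close>

lemma edge_turn_rev:
  assumes "a \<noteq> b"
  shows "edge_turn b a = - edge_turn a b"
proof -
  let ?u = "\<lambda>t. F a b (t + \<eta>) - F a b t"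
  have u: "continuous_on {0..1-\<eta>} ?u" "\<And>t. 0 \<le> t \<Longrightarrow> t \<le> 1 - \<eta> \<Longrightarrow> ?u t \<noteq> 0"
    using eta edge_ne[OF assms] by (auto intro!: continuous_intros)
  have "edge_turn b a = turn (\<lambda>t. - ?u ((1 - \<eta>) - t)) ((1 - \<eta>) - (1 - \<eta>)) ((1 - \<eta>) - 0)"
    unfolding edge_turn_def F_rev[of b a] by (simp add: algebra_simps)
  also have "\<dots> = - edge_turn a b"
    unfolding edge_turn_def by (rule turn_uminus_reverse[OF _ u]) (use eta in auto)
  finally show ?thesis .
qed

lemma corner_turn_rev:
  assumes "distinct [a, b, c]"
  shows "corner_turn c b a = - corner_turn a b c"
proof -
  let ?u = "\<lambda>t. F b c t - F a b (1 - \<eta> + t)"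
  have u: "continuous_on {0..\<eta>} ?u" "\<And>t. 0 \<le> t \<Longrightarrow> t \<le> \<eta> \<Longrightarrow> ?u t \<noteq> 0"
    using eta corner_ne[OF assms] by (auto intro!: continuous_intros)
  have "corner_turn c b a = turn (\<lambda>t. - ?u (\<eta> - t)) (\<eta> - \<eta>) (\<eta> - 0)"
    unfolding corner_turn_def F_rev[of b a] F_rev[of c b] by (simp add: algebra_simps)
  also have "\<dots> = - corner_turn a b c"
    unfolding corner_turn_def by (rule turn_uminus_reverse[OF _ u]) (use eta in auto)
  finally show ?thesis .
qed

lemma start_turn_rev:
  assumes "a \<noteq> b"
  shows "start_turn b a = - end_turn a b"
proof -
  have "turn (\<lambda>t. F a b (1 - t) - X b) (1 - (1 - \<eta>)) (1 - 0) = - turn (\<lambda>t. F a b t - X b) 0 (1 - \<eta>)"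
    by (rule turn_reverse) (use eta end_ne'[OF assms] in \<open>auto intro!: continuous_intros\<close>)
  then show ?thesis by (simp add: start_turn_def end_turn_def F_rev[of b a])
qed

lemma end_turn_rev: "a \<noteq> b \<Longrightarrow> end_turn b a = - start_turn a b"
  using start_turn_rev[of b a] by simp

lemma view_turn_rev:
  assumes "distinct [a, b, c]"
  shows "view_turn c b a = - view_turn c a b"
proof -
  have "turn (\<lambda>t. F a b (1 - t) - X c) (1 - 1) (1 - 0) = - turn (\<lambda>t. F a b t - X c) 0 1"
    by (rule turn_reverse) (use opp_ne[OF assms] in \<open>auto intro!: continuous_intros\<close>)
  then show ?thesis by (simp add: view_turn_def F_rev[of b a])
qed

text \<open>
  The arguments of the floors below are integers, being the turns of closed loops.
\<close>

definition edge_defect :: "'v \<Rightarrow> 'v \<Rightarrow> int" where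
  "edge_defect a b = \<lfloor>Re (edge_turn a b - start_turn a b - end_turn a b)\<rfloor>"

definition corner_defect :: "'v \<Rightarrow> 'v \<Rightarrow> 'v \<Rightarrow> int" where
  "corner_defect a b c = \<lfloor>Re (corner_turn a b c + start_turn b c + end_turn a b
     - view_turn c a b - view_turn a b c)\<rfloor>"

definition opposite_defect :: "'v \<Rightarrow> 'v \<Rightarrow> 'v \<Rightarrow> 'v \<Rightarrow> int" where
  "opposite_defect a b c d = \<lfloor>Re (view_turn c a b + view_turn b c d
     - view_turn d a b - view_turn a c d)\<rfloor>"

text \<open>The three terms run around the triangle of parameters with
  \<open>s + \<eta> \<le> t\<close>: the slanted side gives the edge turn, the two sides where one
  point is an end of the edge are traversed backwards and give the other two. The end directions
  cancel around the closed boundary.\<close>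

lemma edge_defect:
  assumes "a \<noteq> b"
  shows "of_int (edge_defect a b) = edge_turn a b - start_turn a b - end_turn a b"
proof -
  have [simp]: "b \<noteq> a" using assms by auto
  have "F a b \<eta> - X a \<noteq> 0" "X b - F a b (1 - \<eta>) \<noteq> 0" "X b - X a \<noteq> 0"
    using end_ne[OF assms, of \<eta>] end_ne'[OF assms, of "1 - \<eta>"] X_ne[OF assms] eta by auto
  then have "exp (2 * of_real pi * \<i> * (edge_turn a b - start_turn a b - end_turn a b)) = 1"
    using assms
    by (simp add: right_diff_distrib exp_diff exp_edge_turn exp_start_turn exp_end_turn sgn_zero_iff)
  then obtain n where n: "edge_turn a b - start_turn a b - end_turn a b = of_int n"
    by (rule exp_eq_1_imp_int)
  then show ?thesis unfolding edge_defect_def n by simp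
qed

text \<open>The cell is a pentagon, the square of pairs of points on the two edges with the corner
  at the common vertex \<open>b\<close> cut off. The cut gives the corner turn, the sides with one
  point at \<open>b\<close> give the start and end turn, and the sides with one point at
  \<open>c\<close> or \<open>a\<close> are traversed backwards and give the view turns.\<close>

lemma corner_defect:
  assumes "distinct [a, b, c]"
  shows "of_int (corner_defect a b c)
    = corner_turn a b c + start_turn b c + end_turn a b - view_turn c a b - view_turn a b c"
    (is "_ = ?z")
proof -
  have [simp]: "b \<noteq> a" "c \<noteq> a" "c \<noteq> b" using assms by auto
  have ne: "F b c \<eta> - X b \<noteq> 0" "X b - F a b (1 - \<eta>) \<noteq> 0" "X b - X a \<noteq> 0" "X c - X b \<noteq> 0"
      "X c - X a \<noteq> 0"
    using end_ne[of b c \<eta>] end_ne'[of a b "1 - \<eta>"] X_ne[of a b] X_ne[of b c] X_ne[of a c] eta assms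
    by auto
  have "exp (2 * of_real pi * \<i> * ?z) = 1"
    using assms ne
    by (simp add: right_diff_distrib distrib_left exp_diff exp_add exp_corner_turn exp_start_turn
        exp_end_turn exp_view_turn sgn_zero_iff sgn_diff_commute[of "X a" "X c"]
        sgn_diff_commute[of "X b" "X c"])
  then obtain n where n: "?z = of_int n"
    by (rule exp_eq_1_imp_int)
  then show ?thesis unfolding corner_defect_def n by simp
qed

text \<open>Disjoint edges need no truncation: the four view turns are the sides of the full square
  of pairs, with a minus where the boundary runs against the direction of the edge.\<close>

lemma opposite_defect:
  assumes "distinct [a, b, c, d]"
  shows "of_int (opposite_defect a b c d)
    = view_turn c a b + view_turn b c d - view_turn d a b - view_turn a c d"
    (is "_ = ?z")
proof -
  have [simp]: "b \<noteq> a" "c \<noteq> a" "d \<noteq> a" "c \<noteq> b" "d \<noteq> b" "d \<noteq> c" using assms by auto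
  have ne: "X c - X a \<noteq> 0" "X c - X b \<noteq> 0" "X d - X a \<noteq> 0" "X d - X b \<noteq> 0"
    using X_ne[of a c] X_ne[of b c] X_ne[of a d] X_ne[of b d] assms by auto
  have "exp (2 * of_real pi * \<i> * ?z) = 1"
    using assms ne
    by (simp add: right_diff_distrib distrib_left exp_diff exp_add exp_view_turn sgn_zero_iff
        sgn_diff_commute[of "X a" "X c"] sgn_diff_commute[of "X b" "X c"]
        sgn_diff_commute[of "X a" "X d"] sgn_diff_commute[of "X b" "X d"])
  then obtain n where n: "?z = of_int n"
    by (rule exp_eq_1_imp_int)
  then show ?thesis unfolding opposite_defect_def n by simp
qed

section \<open>Sign rules for the defects\<close>

lemma edge_defect_rev:
  assumes "a \<noteq> b"
  shows "edge_defect b a = - edge_defect a b"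
proof -
  have [simp]: "b \<noteq> a" using assms by auto
  have "(of_int (edge_defect b a) :: complex) = of_int (- edge_defect a b)"
    using assms edge_turn_rev[of a b] start_turn_rev[of a b] end_turn_rev[of a b]
    by (simp add: edge_defect)
  then show ?thesis by (simp only: of_int_eq_iff)
qed

lemma corner_defect_rev:
  assumes "distinct [a, b, c]"
  shows "corner_defect c b a = - corner_defect a b c"
proof -
  have [simp]: "b \<noteq> a" "c \<noteq> a" "c \<noteq> b" using assms by auto
  have "(of_int (corner_defect c b a) :: complex) = of_int (- corner_defect a b c)"
    using assms corner_turn_rev[of a b c] start_turn_rev[of a b] end_turn_rev[of b c]
      view_turn_rev[of a b c] view_turn_rev[of b c a]
    by (simp add: corner_defect)
  then show ?thesis by (simp only: of_int_eq_iff)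
qed

text \<open>Exchanging the two edges reflects the square of pairs, so its boundary is traversed in
  the opposite sense.\<close>

lemma opposite_defect_swap:
  assumes "distinct [a, b, c, d]"
  shows "opposite_defect c d a b = - opposite_defect a b c d"
proof -
  have [simp]: "b \<noteq> a" "c \<noteq> a" "d \<noteq> a" "c \<noteq> b" "d \<noteq> b" "d \<noteq> c" using assms by auto
  have "(of_int (opposite_defect c d a b) :: complex) = of_int (- opposite_defect a b c d)"
    using assms by (simp add: opposite_defect)
  then show ?thesis by (simp only: of_int_eq_iff)
qed

lemma opposite_defect_rev:
  assumes "distinct [a, b, c, d]"
  shows "opposite_defect b a c d = - opposite_defect a b c d"
proof -
  have [simp]: "b \<noteq> a" "c \<noteq> a" "d \<noteq> a" "c \<noteq> b" "d \<noteq> b" "d \<noteq> c" using assms by auto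
  have "(of_int (opposite_defect b a c d) :: complex) = of_int (- opposite_defect a b c d)"
    using assms view_turn_rev[of a b c] view_turn_rev[of a b d] by (simp add: opposite_defect)
  then show ?thesis by (simp only: of_int_eq_iff)
qed

lemma opposite_defect_rev':
  assumes "distinct [a, b, c, d]"
  shows "opposite_defect a b d c = - opposite_defect a b c d"
proof -
  have [simp]: "b \<noteq> a" "c \<noteq> a" "d \<noteq> a" "c \<noteq> b" "d \<noteq> b" "d \<noteq> c" using assms by auto
  show ?thesis
    using assms opposite_defect_swap[of a b c d] opposite_defect_swap[of a b d c]
      opposite_defect_rev[of c d a b] by simp
qed

section \<open>Total turn around a triangle and around a square\<close>

definition triangle_defect :: "'v \<Rightarrow> 'v \<Rightarrow> 'v \<Rightarrow> int" where
  "triangle_defect a b c = edge_defect a b + edge_defect b c + edge_defect c a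
     + corner_defect a b c + corner_defect b c a + corner_defect c a b"

definition square_defect :: "'v \<Rightarrow> 'v \<Rightarrow> 'v \<Rightarrow> 'v \<Rightarrow> int" where
  "square_defect a b c d = edge_defect a b + edge_defect b c + edge_defect c d + edge_defect d a
     + corner_defect a b c + corner_defect b c d + corner_defect c d a + corner_defect d a b
     + opposite_defect a b c d + opposite_defect b c d a"

lemma triangle_turn:
  assumes "distinct [a, b, c]"
  obtains n where "edge_turn a b + corner_turn a b c + (edge_turn b c + corner_turn b c a)
    + (edge_turn c a + corner_turn c a b) = of_int (triangle_defect a b c + 2 * n + 1)"
proof -
  have [simp]: "b \<noteq> a" "c \<noteq> a" "c \<noteq> b" using assms by auto
  \<comment> \<open>The start and end turns cancel, and each view turn enters through two corners.\<close>
  let ?z = "view_turn c a b + view_turn a b c + view_turn b c a"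
  have ne: "X a - X b \<noteq> 0" "X b - X c \<noteq> 0" "X c - X a \<noteq> 0"
    using X_ne[of a b] X_ne[of b c] X_ne[of c a] assms by auto
  \<comment> \<open>Taken in the order \<open>view_turn c a b\<close>,
    \<open>view_turn b c a\<close>, \<open>view_turn a b c\<close>, and with the sign of the middle
    difference reversed, the moves lead from \<open>X a - X c\<close> over \<open>X b - X c\<close>
    and \<open>X b - X a\<close> to \<open>X c - X a\<close>.\<close>
  have "exp (2 * of_real pi * \<i> * ?z) = -1"
    using assms ne
    by (simp add: distrib_left exp_add exp_view_turn sgn_zero_iff sgn_diff_commute[of "X a" "X c"]
        sgn_diff_commute[of "X c" "X b"] sgn_diff_commute[of "X b" "X a"])
  then obtain n where n: "2 * ?z = of_int (2 * n + 1)" by (rule exp_eq_minus_1_imp_odd)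
  have "of_int (triangle_defect a b c + 2 * n + 1) = of_int (triangle_defect a b c) + 2 * ?z"
    unfolding n by simp
  then show thesis
    using assms by (intro that[of n]) (simp add: triangle_defect_def edge_defect corner_defect)
qed

lemma square_turn:
  assumes "distinct [a, b, c, d]"
  obtains n where "edge_turn a b + corner_turn a b c + (edge_turn b c + corner_turn b c d)
    + (edge_turn c d + corner_turn c d a) + (edge_turn d a + corner_turn d a b)
    = of_int (square_defect a b c d + 2 * n + 1)"
proof -
  have [simp]: "b \<noteq> a" "c \<noteq> a" "d \<noteq> a" "c \<noteq> b" "d \<noteq> b" "d \<noteq> c" using assms by auto
  \<comment> \<open>Of the eight view turns, the two opposite defects remove four and double the others.\<close>
  let ?z = "view_turn d a b + view_turn a c d + view_turn a b c + view_turn b d a"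
  have ne: "X a - X b \<noteq> 0" "X a - X c \<noteq> 0" "X a - X d \<noteq> 0" "X b - X d \<noteq> 0"
    using X_ne[of a b] X_ne[of a c] X_ne[of a d] X_ne[of b d] assms by auto
  \<comment> \<open>The order \<open>view_turn d a b\<close>, \<open>view_turn b d a\<close> with
    reversed sign of the difference, \<open>view_turn a b c\<close>, \<open>view_turn a c d\<close>
    gives a path from \<open>X a - X d\<close> over \<open>X b - X d\<close>,
    \<open>X b - X a\<close> and \<open>X c - X a\<close> to \<open>X d - X a\<close>.\<close>
  have "exp (2 * of_real pi * \<i> * ?z) = -1"
    using assms ne
    by (simp add: distrib_left exp_add exp_view_turn sgn_zero_iff sgn_diff_commute[of "X b" "X a"]
        sgn_diff_commute[of "X c" "X a"] sgn_diff_commute[of "X d" "X a"]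
        sgn_diff_commute[of "X d" "X b"])
  then obtain n where n: "2 * ?z = of_int (2 * n + 1)" by (rule exp_eq_minus_1_imp_odd)
  have "of_int (square_defect a b c d + 2 * n + 1) = of_int (square_defect a b c d) + 2 * ?z"
    unfolding n by simp
  then show thesis
    using assms
    by (intro that[of n]) (simp add: square_defect_def edge_defect corner_defect opposite_defect)
qed

lemma triangle_defect_rev:
  assumes "distinct [a, b, c]"
  shows "triangle_defect c b a = - triangle_defect a b c"
proof -
  have [simp]: "b \<noteq> a" "c \<noteq> a" "c \<noteq> b" using assms by auto
  show ?thesis
    using assms edge_defect_rev[of a b] edge_defect_rev[of b c] edge_defect_rev[of c a]
      corner_defect_rev[of a b c] corner_defect_rev[of b c a] corner_defect_rev[of c a b]
    by (simp add: triangle_defect_def)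
qed

text \<open>In contrast to the triangle there is no exact sign rule: all edge and corner defects and
  the first opposite defect change sign, but the second opposite defect keeps its sign. Only the
  parity is invariant.\<close>

lemma square_defect_rev:
  assumes "distinct [a, b, c, d]"
  shows "even (square_defect d c b a - square_defect a b c d)"
proof -
  have [simp]: "b \<noteq> a" "c \<noteq> a" "d \<noteq> a" "c \<noteq> b" "d \<noteq> b" "d \<noteq> c" using assms by auto
  show ?thesis
    using assms edge_defect_rev[of a b] edge_defect_rev[of b c] edge_defect_rev[of c d]
      edge_defect_rev[of d a] corner_defect_rev[of a b c] corner_defect_rev[of b c d]
      corner_defect_rev[of c d a] corner_defect_rev[of d a b]
      opposite_defect_swap[of b a d c] opposite_defect_rev[of a b d c] opposite_defect_rev'[of a b c d]
      opposite_defect_rev[of b c a d] opposite_defect_rev'[of b c d a]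
    by (simp add: square_defect_def)
qed

lemma even_sum_defects:
  assumes "distinct [a, b, c, d]"
  shows "even (triangle_defect a b c + triangle_defect a b d + triangle_defect a c d
    + triangle_defect b c d + square_defect a b c d + square_defect a b d c
    + square_defect a c b d)"
proof -
  have [simp]: "b \<noteq> a" "c \<noteq> a" "d \<noteq> a" "c \<noteq> b" "d \<noteq> b" "d \<noteq> c" using assms by auto
  show ?thesis
    \<comment> \<open>These facts identify, up to sign, all defects that belong to the same edge or
      pair of edges, so that every remaining term has an even coefficient.\<close>
    using assms edge_defect_rev[of a b] edge_defect_rev[of a c] edge_defect_rev[of a d]
      edge_defect_rev[of b c] edge_defect_rev[of b d] edge_defect_rev[of c d]
      corner_defect_rev[of a b c] corner_defect_rev[of b c a] corner_defect_rev[of c a b]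
      corner_defect_rev[of a b d] corner_defect_rev[of b d a] corner_defect_rev[of d a b]
      corner_defect_rev[of a c d] corner_defect_rev[of c d a] corner_defect_rev[of d a c]
      corner_defect_rev[of b c d] corner_defect_rev[of c d b] corner_defect_rev[of d b c]
      opposite_defect_rev'[of a b c d] opposite_defect_rev[of b c d a]
      opposite_defect_rev'[of b d a c] opposite_defect_swap[of a c b d]
    unfolding triangle_defect_def square_defect_def by simp
qed

end

section \<open>Rotation number of a reparametrised closed curve\<close>

text \<open>The period \<open>k\<close> is left general because the curves of interest spend one
  unit of parameter on each edge; \<delta> is a uniform bound on the lag below which secants do not
  vanish.\<close>

locale locally_injective_periodic =
  fixes C :: "real \<Rightarrow> complex" and k \<delta> :: real
  assumes cont: "continuous_on UNIV C" and period: "C (t + k) = C t"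
    and delta: "0 < \<delta>" and ne: "s < t \<Longrightarrow> t < s + \<delta> \<Longrightarrow> C s \<noteq> C t"
begin

lemma continuous_on_C [continuous_intros]:
  "continuous_on S h \<Longrightarrow> continuous_on S (\<lambda>x. C (h x))"
  using continuous_on_compose2[OF cont] by blast

text \<open>The set of pairs with \<open>\<phi> < \<psi> < \<phi> + \<delta>\<close> is convex, so
  linear interpolation between two curves of such pairs never meets a vanishing secant. The shifts
  by the period keep all intermediate curves closed.\<close>

lemma winding_number_secant_eq:
  assumes cont: "continuous_on {0..1} \<phi>" "continuous_on {0..1} \<psi>"
      "continuous_on {0..1} \<phi>'" "continuous_on {0..1} \<psi>'"
    and shift: "\<phi> 1 = \<phi> 0 + k" "\<psi> 1 = \<psi> 0 + k" "\<phi>' 1 = \<phi>' 0 + k" "\<psi>' 1 = \<psi>' 0 + k"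
    and less: "\<And>t. 0 \<le> t \<Longrightarrow> t \<le> 1 \<Longrightarrow> \<phi> t < \<psi> t \<and> \<psi> t < \<phi> t + \<delta>"
      "\<And>t. 0 \<le> t \<Longrightarrow> t \<le> 1 \<Longrightarrow> \<phi>' t < \<psi>' t \<and> \<psi>' t < \<phi>' t + \<delta>"
  shows "winding_number (\<lambda>t. sgn (C (\<psi> t) - C (\<phi> t))) 0
    = winding_number (\<lambda>t. sgn (C (\<psi>' t) - C (\<phi>' t))) 0"
proof (rule winding_number_homotopic_loops)
  define \<Phi> where "\<Phi> = (\<lambda>z::real \<times> real. (1 - fst z) * \<phi> (snd z) + fst z * \<phi>' (snd z))"
  define \<Psi> where "\<Psi> = (\<lambda>z::real \<times> real. (1 - fst z) * \<psi> (snd z) + fst z * \<psi>' (snd z))"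
  have "continuous_on ({0..1} \<times> {0..1}) \<Phi>" "continuous_on ({0..1} \<times> {0..1}) \<Psi>"
    unfolding \<Phi>_def \<Psi>_def
    by (auto intro!: continuous_intros cont[THEN continuous_on_compose2])
  moreover have C_ne: "C (\<Psi> (x, t)) \<noteq> C (\<Phi> (x, t))" if "x \<in> {0..1}" "t \<in> {0..1}" for x t
  proof -
    have "\<Psi> (x, t) - \<Phi> (x, t) = (1 - x) * (\<psi> t - \<phi> t) + x * (\<psi>' t - \<phi>' t)"
      by (simp add: \<Phi>_def \<Psi>_def algebra_simps)
    moreover have "\<dots> \<in> {0<..<\<delta>}"
      using less[of t] that
        convexD[OF convex_real_interval(8), of "\<psi> t - \<phi> t" 0 \<delta> "\<psi>' t - \<phi>' t" "1 - x" x]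
      by auto
    ultimately show ?thesis using ne[of "\<Phi> (x, t)" "\<Psi> (x, t)"] by auto
  qed
  moreover have "C (\<Psi> (x, 1)) = C (\<Psi> (x, 0))" "C (\<Phi> (x, 1)) = C (\<Phi> (x, 0))" for x
    using period[of "\<Psi> (x, 0)"] period[of "\<Phi> (x, 0)"]
    by (simp_all add: \<Phi>_def \<Psi>_def shift algebra_simps)
  ultimately show "homotopic_loops (- {0}) (\<lambda>t. sgn (C (\<psi> t) - C (\<phi> t)))
      (\<lambda>t. sgn (C (\<psi>' t) - C (\<phi>' t)))"
    unfolding homotopic_loops
    by (intro exI[of _ "\<lambda>z. sgn (C (\<Psi> z) - C (\<Phi> z))"])
       (auto intro!: continuous_intros simp: sgn_zero_iff pathfinish_def pathstart_def,
        simp_all add: \<Phi>_def \<Psi>_def)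
qed

text \<open>A small constant lag \<epsilon> for \<open>g\<close> is a variable lag
  \<open>\<theta> (t + \<epsilon>) - \<theta> t\<close> for \<open>C\<close>, which uniform
  continuity keeps below \<delta>. The homotopy above replaces it by the constant lag \<eta>, so
  that no limit is left.\<close>

lemma rotation_number_eq_turn:
  assumes \<theta>: "continuous_on UNIV \<theta>" "strict_mono \<theta>" "\<And>t. \<theta> (t + 1) = \<theta> t + k"
    and g: "\<And>t. g (frac t) = C (\<theta> t)"
    and \<eta>: "0 < \<eta>" "\<eta> < \<delta>"
  shows "of_int (rotation_number g) = turn (\<lambda>t. C (t + \<eta>) - C t) 0 k"
proof -
  define w where "w = winding_number (\<lambda>t. sgn (C (k * t + \<eta>) - C (k * t))) 0"
  have "w \<in> \<int>" unfolding w_def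
  proof (rule integer_winding_number)
    have "C (k * t + \<eta>) - C (k * t) \<noteq> 0" for t using ne[of "k * t" "k * t + \<eta>"] \<eta> by auto
    then show "path (\<lambda>t. sgn (C (k * t + \<eta>) - C (k * t)))"
      and "0 \<notin> path_image (\<lambda>t. sgn (C (k * t + \<eta>) - C (k * t)))"
      unfolding path_def by (auto intro!: continuous_intros simp: path_image_def sgn_zero_iff)
    show "pathfinish (\<lambda>t. sgn (C (k * t + \<eta>) - C (k * t)))
        = pathstart (\<lambda>t. sgn (C (k * t + \<eta>) - C (k * t)))"
      using period[of 0] period[of \<eta>] by (simp add: pathfinish_def pathstart_def add.commute)
  qed
  then obtain n where n: "w = of_int n" by (auto elim: Ints_cases)
  \<comment> \<open>The interval extends to 2 so as to contain \<open>t + \<epsilon>\<close> for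
    \<open>t \<le> 1\<close> and \<open>\<epsilon> < 1\<close>.\<close>
  have "uniformly_continuous_on {0..2} \<theta>"
    by (intro compact_uniformly_continuous continuous_on_subset[OF \<theta>(1)]) auto
  then obtain d where d: "d > 0" "\<And>s t. s \<in> {0..2} \<Longrightarrow> t \<in> {0..2} \<Longrightarrow> dist t s < d \<Longrightarrow> dist (\<theta> t) (\<theta> s) < \<delta>"
    using delta unfolding uniformly_continuous_on_def by metis
  have "\<forall>\<^sub>F \<epsilon> in at_right 0. \<epsilon> \<in> {0<..<min d 1}"
    using d(1) by (intro eventually_at_right_real) auto
  then have ev: "\<forall>\<^sub>F \<epsilon> in at_right 0. winding_number (\<lambda>t. sgn (g (frac (t + \<epsilon>)) - g (frac t))) 0 = w"
  proof eventually_elim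
    case (elim \<epsilon>)
    have "\<theta> t < \<theta> (t + \<epsilon>) \<and> \<theta> (t + \<epsilon>) < \<theta> t + \<delta>" if "0 \<le> t" "t \<le> 1" for t
      using strict_monoD[OF \<theta>(2), of t "t + \<epsilon>"] d(2)[of t "t + \<epsilon>"] elim that
      by (auto simp: dist_real_def)
    then show ?case unfolding w_def g
      using \<theta>(3)[of 0] \<theta>(3)[of \<epsilon>] \<eta>
      by (intro winding_number_secant_eq)
         (auto intro!: continuous_intros continuous_on_compose2[OF \<theta>(1)] simp: add.commute)
  qed
  have "rotation_number g = n"
    unfolding rotation_number_def Let_def
  proof (rule the_equality)
    show "\<forall>\<^sub>F \<epsilon> in at_right 0. winding_number (\<lambda>t. sgn (g (frac (t + \<epsilon>)) - g (frac t))) 0 = of_int n"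
      using ev n by simp
    fix m :: int
    assume "\<forall>\<^sub>F \<epsilon> in at_right 0. winding_number (\<lambda>t. sgn (g (frac (t + \<epsilon>)) - g (frac t))) 0 = of_int m"
    then have "\<forall>\<^sub>F \<epsilon> in at_right (0::real). of_int m = (of_int n :: complex)"
      using ev by eventually_elim (simp add: n)
    then show "m = n" by simp
  qed
  then show ?thesis using n by (simp add: w_def turn_def)
qed

end

section \<open>Reparametrisation of simple loops\<close>

lemma periodic_frac:
  fixes q :: "real \<Rightarrow> 'a"
  assumes "\<And>s t. s - t \<in> \<int> \<Longrightarrow> q s = q t"
  shows "q (frac t) = q t"
  by (rule assms) (simp add: frac_def)

text \<open>The extension of \<open>h\<close> commuting with integer shifts is strictly increasing
  and surjective; a monotone function without gaps in its range is continuous.\<close>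

lemma increasing_reparametrization:
  fixes P q :: "real \<Rightarrow> 'a"
  assumes P: "\<And>s t. s - t \<in> \<int> \<Longrightarrow> P s = P t" and q: "\<And>s t. s - t \<in> \<int> \<Longrightarrow> q s = q t"
    and start: "P 0 = q 0"
    and h: "strict_mono_on {0<..<1} h" "h ` {0<..<1} = {0<..<1}"
    and eq: "\<And>t. t \<in> {0<..<1} \<Longrightarrow> q (h t) = P t"
  obtains \<theta> :: "real \<Rightarrow> real" where "continuous_on UNIV \<theta>" "strict_mono \<theta>"
    "\<And>t. \<theta> (t + 1) = \<theta> t + 1" "\<And>t. P t = q (\<theta> t)"
proof
  \<comment> \<open>The value 0 at 0 matches \<open>P 0 = q 0\<close> and makes \<theta> fix every
    integer.\<close>
  define h' where "h' = (\<lambda>t. if t = 0 then 0 else h t)"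
  define \<theta> where "\<theta> = (\<lambda>t. of_int \<lfloor>t\<rfloor> + h' (frac t))"
  have h'_range: "0 \<le> h' t" "h' t < 1" if "0 \<le> t" "t < 1" for t
  proof -
    have "t \<noteq> 0 \<Longrightarrow> h t \<in> {0<..<1}" using h(2) that by auto
    then show "0 \<le> h' t" "h' t < 1" by (auto simp: h'_def)
  qed
  have h'_less: "h' s < h' t" if "0 \<le> s" "s < t" "t < 1" for s t
  proof -
    have "h t \<in> {0<..<1}" using h(2) that by auto
    then show ?thesis using strict_mono_onD[OF h(1), of s t] that by (auto simp: h'_def)
  qed
  show mono: "strict_mono \<theta>"
  proof (rule strict_monoI)
    fix s t :: real assume "s < t"
    then consider "\<lfloor>s\<rfloor> = \<lfloor>t\<rfloor>" "frac s < frac t" | "\<lfloor>s\<rfloor> + 1 \<le> \<lfloor>t\<rfloor>"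
      using floor_mono[of s t] by (force simp: frac_def)
    then show "\<theta> s < \<theta> t"
    proof cases
      case 1
      then show ?thesis using h'_less[of "frac s" "frac t"] by (simp add: \<theta>_def frac_lt_1)
    next
      case 2
      then have "of_int \<lfloor>s\<rfloor> + 1 \<le> (of_int \<lfloor>t\<rfloor> :: real)" by linarith
      then show ?thesis
        using h'_range(2)[of "frac s"] h'_range(1)[of "frac t"] by (simp add: \<theta>_def frac_lt_1)
    qed
  qed
  have "surj \<theta>"
  proof (rule surjI)
    fix y :: real
    define x where "x = (if frac y = 0 then 0 else inv_into {0<..<1} h (frac y))"
    have "x \<in> {0..<1} \<and> h' x = frac y"
    proof (cases "frac y = 0")
      case False
      then have "frac y \<in> {0<..<1}" using frac_lt_1[of y] frac_ge_0[of y] by (auto simp: less_le)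
      then have "frac y \<in> h ` {0<..<1}" using h(2) by blast
      then have "inv_into {0<..<1} h (frac y) \<in> {0<..<1}" "h (inv_into {0<..<1} h (frac y)) = frac y"
        by (rule inv_into_into, rule f_inv_into_f)
      then show ?thesis using False by (auto simp: x_def h'_def)
    qed (auto simp: x_def h'_def)
    then show "\<theta> (of_int \<lfloor>y\<rfloor> + (if frac y = 0 then 0 else inv_into {0<..<1} h (frac y))) = y"
      unfolding x_def[symmetric]
      by (simp add: \<theta>_def frac_def floor_unique[of 0])
  qed
  then show "continuous_on UNIV \<theta>"
    using mono by (intro continuous_onI_mono) (auto simp: strict_mono_less_eq)
  show "\<theta> (t + 1) = \<theta> t + 1" for t
    by (simp add: \<theta>_def frac_def)
  show "P t = q (\<theta> t)" for t
  proof -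
    have "q (\<theta> t) = q (h' (frac t))" by (rule q) (simp add: \<theta>_def)
    also have "\<dots> = P (frac t)"
    proof (cases "frac t = 0")
      case False
      then have "frac t \<in> {0<..<1}" using frac_lt_1[of t] frac_ge_0[of t] by (auto simp: less_le)
      then show ?thesis using eq False by (simp add: h'_def)
    qed (simp only: h'_def start simp_thms if_True)
    finally show ?thesis using periodic_frac[of P t] P by simp
  qed
qed

text \<open>Both maps are embeddings of the circle with the same image, hence differ by a
  homeomorphism of the circle. Once the base points agree, it restricts to a continuous injection of
  the open unit interval, which is monotone; the two kinds of monotonicity are the two
  orientations.\<close>

lemma loop_reparametrization:
  fixes P q :: "real \<Rightarrow> 'a::euclidean_space"
  assumes cont: "continuous_on UNIV P" "continuous_on UNIV q"
    and P: "\<And>s t. P s = P t \<longleftrightarrow> s - t \<in> \<int>" and q: "\<And>s t. q s = q t \<longleftrightarrow> s - t \<in> \<int>"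
    and range: "range P = range q"
  obtains \<theta> :: "real \<Rightarrow> real" where "continuous_on UNIV \<theta>" "strict_mono \<theta>"
    "\<And>t. \<theta> (t + 1) = \<theta> t + 1" "(\<forall>t. P t = q (\<theta> t)) \<or> (\<forall>t. P t = q (- \<theta> t))"
proof -
  obtain c where "P 0 = q c" using range by blast
  define r where "r = (\<lambda>t. q (t + c))"
  have r: "r s = r t \<longleftrightarrow> s - t \<in> \<int>" for s t by (simp add: r_def q)
  have cont_r: "continuous_on S r" for S
    unfolding r_def by (intro continuous_on_compose2[OF cont(2)] continuous_intros) auto
  have start: "P 0 = r 0" using \<open>P 0 = q c\<close> by (simp add: r_def)
  have unit_diff: "s - t \<in> \<int> \<longleftrightarrow> s = t" if "s \<in> {0<..<1}" "t \<in> {0<..<1}" for s t :: real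
    using that by (auto elim!: Ints_cases simp: algebra_simps)
  have unit_not_Int: "t \<notin> \<int>" if "t \<in> {0<..<1}" for t :: real
    using that by (auto elim!: Ints_cases)
  have lift: "\<exists>y\<in>{0<..<1}. v y = u t"
    if t: "t \<in> {0<..<1}" and u: "\<And>s t. u s = u t \<longleftrightarrow> s - t \<in> \<int>"
      and v: "\<And>s t. v s = v t \<longleftrightarrow> s - t \<in> \<int>"
      and uv: "u 0 = v 0" "range u \<subseteq> range v" for t and u v :: "real \<Rightarrow> 'a"
  proof -
    have "u t \<in> range v" using uv(2) by blast
    then obtain y where "u t = v y" by blast
    then have "v (frac y) = u t" using periodic_frac[of v y] v by simp
    moreover from this have "frac y \<noteq> 0" using u[of t 0] t uv(1) unit_not_Int[of t] by force
    ultimately show ?thesis using frac_lt_1[of y] frac_ge_0[of y]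
      by (intro bexI[of _ "frac y"]) (auto simp: less_le)
  qed
  have range_r: "range r = range P"
  proof -
    have "q y = r (y - c)" for y by (simp add: r_def)
    then have "range q \<subseteq> range r" by (metis image_subsetI rangeI)
    then show ?thesis unfolding range by (auto simp: r_def)
  qed
  define h where "h = (\<lambda>t. SOME y. y \<in> {0<..<1} \<and> r y = P t)"
  have h: "h t \<in> {0<..<1} \<and> r (h t) = P t" if "t \<in> {0<..<1}" for t
    unfolding h_def by (rule someI_ex) (use lift[OF that, of P r] P r start range_r in blast)
  have inj: "inj_on h {0<..<1}"
  proof (rule inj_onI)
    fix s t :: real assume st: "s \<in> {0<..<1}" "t \<in> {0<..<1}" "h s = h t"
    then have "P s = P t" using h[of s] h[of t] by simp
    then show "s = t" using P unit_diff[OF st(1,2)] by simp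
  qed
  have im: "h ` {0<..<1} = {0<..<1}"
  proof
    show "{0<..<1} \<subseteq> h ` {0<..<1}"
    proof
      fix y :: real assume y: "y \<in> {0<..<1}"
      then obtain t where t: "t \<in> {0<..<1}" "P t = r y"
        using lift[OF y, of r P] P r start range_r by force
      then have "h t = y" using h[OF t(1)] r[of "h t" y] unit_diff[of "h t" y] y by simp
      then show "y \<in> h ` {0<..<1}" using t by auto
    qed
  qed (use h in auto)
  \<comment> \<open>A function into the compact interval \<open>{0..1}\<close> is continuous if its
    graph is closed. Admitting the values 0 and 1 adds nothing to the graph, since \<open>r\<close>
    takes the value \<open>P 0\<close> there, which \<open>P\<close> avoids inside the unit
    interval.\<close>
  have "continuous_on {0<..<1} h"
  proof -
    have "(\<lambda>t. (t, h t)) ` {0<..<1} = {z \<in> {0<..<1} \<times> {0..1}. r (snd z) - P (fst z) = 0}"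
    proof (intro set_eqI iffI)
      fix z assume z: "z \<in> {z \<in> {0<..<1} \<times> {0..1}. r (snd z) - P (fst z) = 0}"
      obtain t y where [simp]: "z = (t, y)" by force
      have ty: "t \<in> {0<..<1}" "y \<in> {0..1}" "r y = P t" using z by auto
      then have "y \<noteq> 0 \<and> y \<noteq> 1"
        using P[of t 0] start unit_not_Int[of t] r[of 0 1] by auto
      then have "h t = y" using h[OF ty(1)] r[of "h t" y] unit_diff[of "h t" y] ty by simp
      then show "z \<in> (\<lambda>t. (t, h t)) ` {0<..<1}" using ty by auto
    qed (use h in \<open>auto simp: less_imp_le\<close>)
    moreover have "closedin (top_of_set ({0<..<1} \<times> {0..1})) {z \<in> {0<..<1} \<times> {0..1}. r (snd z) - P (fst z) = 0}"
      by (intro continuous_closedin_preimage_constant continuous_intros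
          continuous_on_compose2[OF cont(1)] continuous_on_compose2[OF cont_r[of UNIV]]) auto
    ultimately show ?thesis
      using h by (subst continuous_closed_graph_eq[where T = "{0..1}"]) (auto simp: less_imp_le Pi_iff)
  qed
  then consider "strict_mono_on {0<..<1} h" | "strict_antimono_on {0<..<1} h"
    using injective_eq_monotone_map[of "{0<..<1}" h] inj is_interval_oo by blast
  then show thesis
  proof cases
    case 1
    obtain \<theta> where \<theta>: "continuous_on UNIV \<theta>" "strict_mono \<theta>" "\<And>t. \<theta> (t + 1) = \<theta> t + 1"
        "\<And>t. P t = r (\<theta> t)"
      using increasing_reparametrization[of P r h] P r start 1 im h by blast
    show thesis
      by (rule that[of "\<lambda>t. \<theta> t + c"])
         (use \<theta> in \<open>auto intro!: continuous_intros simp: strict_mono_def r_def\<close>)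
  next
    case 2
    \<comment> \<open>The increasing case applies to \<open>1 - h\<close> and the backward curve
      \<open>r (- t)\<close>, because \<open>- (1 - h t)\<close> and \<open>h t\<close> differ by
      the period 1.\<close>
    have mono': "strict_mono_on {0<..<1} (\<lambda>t. 1 - h t)"
      using 2 by (auto simp: monotone_on_def)
    have im': "(\<lambda>t. 1 - h t) ` {0<..<1} = {0<..<1}"
    proof -
      have "(\<lambda>t. 1 - h t) ` {0<..<1} = (\<lambda>y. 1 - y) ` (h ` {0<..<1})" by (simp add: image_image)
      also have "\<dots> = {0<..<1}"
      proof -
        have "(\<lambda>y. 1 - y) ` {0<..<1} \<subseteq> {0<..<1::real}" by auto
        moreover have "{0<..<1::real} \<subseteq> (\<lambda>y. 1 - y) ` {0<..<1}"
        proof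
          fix y :: real assume "y \<in> {0<..<1}"
          then show "y \<in> (\<lambda>y. 1 - y) ` {0<..<1}" by (intro image_eqI[of _ _ "1 - y"]) auto
        qed
        ultimately show ?thesis unfolding im by (rule equalityI)
      qed
      finally show ?thesis .
    qed
    have eq': "r (- (1 - h t)) = P t" if "t \<in> {0<..<1}" for t
      using h[OF that] r[of "h t - 1" "h t"] by simp
    have r': "r (- s) = r (- t)" if "s - t \<in> \<int>" for s t
      using that Ints_minus[OF that] r by simp
    have start': "P 0 = r (- 0)" using start by simp
    obtain \<theta> where \<theta>: "continuous_on UNIV \<theta>" "strict_mono \<theta>"
        "\<And>t. \<theta> (t + 1) = \<theta> t + 1" "\<And>t. P t = r (- \<theta> t)"
      by (rule increasing_reparametrization[of P "\<lambda>t. r (- t)", OF _ r' start' mono' im' eq'])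
         (use P in auto)
    show thesis
      by (rule that[of "\<lambda>t. \<theta> t - c"])
         (use \<theta> in \<open>auto intro!: continuous_intros simp: strict_mono_def r_def\<close>)
  qed
qed

lemma continuous_on_unit_intervals:
  fixes g :: "real \<Rightarrow> 'a::topological_space"
  assumes "\<And>n::int. continuous_on {of_int n..of_int n + 1} g"
  shows "continuous_on UNIV g"
  unfolding continuous_on_eq_continuous_at[OF open_UNIV]
proof
  fix x :: real
  \<comment> \<open>The interval on the left is included in case \<open>x\<close> is an integer: the
    union of the two is a neighbourhood of \<open>x\<close> either way.\<close>
  let ?m = "of_int (\<lfloor>x\<rfloor> - 1) :: real"
  have "continuous_on ({?m..?m + 1} \<union> {of_int \<lfloor>x\<rfloor>..of_int \<lfloor>x\<rfloor> + 1}) g"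
    by (intro continuous_on_closed_Un assms) auto
  then have "continuous_on {?m<..<of_int \<lfloor>x\<rfloor> + 1} g"
    by (rule continuous_on_subset) auto
  moreover have "x \<in> {?m<..<of_int \<lfloor>x\<rfloor> + 1}"
    using floor_correct[of x] by simp linarith
  ultimately show "isCont g x"
    by (metis continuous_on_eq_continuous_at open_greaterThanLessThan)
qed

lemma simple_loop_periodic_extension:
  fixes p :: "real \<Rightarrow> 'a::metric_space"
  assumes "simple_path p" "pathfinish p = pathstart p"
  shows "continuous_on UNIV (\<lambda>t. p (frac t))"
    and "p (frac s) = p (frac t) \<longleftrightarrow> s - t \<in> \<int>"
    and "range (\<lambda>t. p (frac t)) = path_image p"
proof -
  have p01: "p 0 = p 1" using assms(2) by (simp add: pathfinish_def pathstart_def)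
  have cont: "continuous_on {0..1} p" using assms(1) by (simp add: simple_path_def path_def)
  have piece: "continuous_on {of_int n..of_int n + 1} (\<lambda>t. p (frac t))" for n :: int
  proof -
    have "p (frac t) = p (t - of_int n)" if "t \<in> {of_int n..of_int n + 1}" for t
    proof (cases "t = of_int n + 1")
      case True
      then show ?thesis using p01 by (simp add: frac_def)
    next
      case False
      then have "\<lfloor>t\<rfloor> = n" using that by (intro floor_unique) auto
      then show ?thesis by (simp add: frac_def)
    qed
    moreover have "continuous_on {of_int n..of_int n + 1} (\<lambda>t. p (t - of_int n))"
      by (intro continuous_on_compose2[OF cont] continuous_intros) auto
    ultimately show ?thesis by (subst continuous_on_cong[OF refl]) auto
  qed
  then show "continuous_on UNIV (\<lambda>t. p (frac t))" by (rule continuous_on_unit_intervals)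
  show "p (frac s) = p (frac t) \<longleftrightarrow> s - t \<in> \<int>"
  proof
    assume "p (frac s) = p (frac t)"
    then have "frac s = frac t"
      using assms(1) frac_ge_0[of s] frac_ge_0[of t] frac_lt_1[of s] frac_lt_1[of t]
      unfolding simple_path_def loop_free_def by (metis atLeastAtMost_iff less_irrefl less_imp_le)
    then have "s - t = of_int (\<lfloor>s\<rfloor> - \<lfloor>t\<rfloor>)" by (simp add: frac_def)
    then show "s - t \<in> \<int>" by (metis Ints_of_int)
  next
    assume "s - t \<in> \<int>"
    then obtain n where "s = t + of_int n" by (metis Ints_cases add.commute diff_add_cancel)
    then show "p (frac s) = p (frac t)" by (simp add: frac_def)
  qed
  show "range (\<lambda>t. p (frac t)) = path_image p"
  proof
    show "path_image p \<subseteq> range (\<lambda>t. p (frac t))"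
    proof
      fix y assume "y \<in> path_image p"
      then obtain t where t: "t \<in> {0..1}" "y = p t" by (auto simp: path_image_def)
      then have "y = p (frac t)"
        using p01 by (cases "t = 1") (auto simp: frac_eq[THEN iffD2])
      then show "y \<in> range (\<lambda>t. p (frac t))" by blast
    qed
  qed (auto simp: path_image_def less_imp_le[OF frac_lt_1])
qed

section \<open>The closed curve of a cyclic vertex sequence\<close>

context immersed_complete_graph
begin

text \<open>Indexing the vertices by all integers makes the curve periodic for a periodic sequence,
  and its reversal becomes the sequence \<open>v (- i)\<close>.\<close>

definition curve :: "(int \<Rightarrow> 'v) \<Rightarrow> real \<Rightarrow> complex" where
  "curve v t = F (v \<lfloor>t\<rfloor>) (v (\<lfloor>t\<rfloor> + 1)) (frac t)"

lemma curve_on_edge: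
  assumes "of_int i \<le> t" "t \<le> of_int i + 1"
  shows "curve v t = F (v i) (v (i + 1)) (t - of_int i)"
proof (cases "t = of_int i + 1")
  case True
  then show ?thesis by (simp add: curve_def frac_def F_0 F_1 add.commute)
next
  case False
  then have "\<lfloor>t\<rfloor> = i" using assms by (intro floor_unique) auto
  then show ?thesis by (simp add: curve_def frac_def)
qed

lemma continuous_on_curve: "continuous_on S (curve v)"
proof -
  have "continuous_on {of_int n..of_int n + 1} (curve v)" for n :: int
    by (subst continuous_on_cong[OF refl curve_on_edge]) (auto intro!: continuous_intros)
  then have "continuous_on UNIV (curve v)" by (rule continuous_on_unit_intervals)
  then show ?thesis by (rule continuous_on_subset) simp
qed

lemma curve_near_edge:
  assumes "of_int i \<le> t" "t \<le> of_int i + (1 - \<eta>)"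
  shows "curve v (t + \<eta>) = F (v i) (v (i + 1)) (t - of_int i + \<eta>)"
    and "curve v t = F (v i) (v (i + 1)) (t - of_int i)"
  using assms eta curve_on_edge[of i] by (auto simp: algebra_simps)

lemma curve_near_corner:
  assumes "0 \<le> r" "r \<le> \<eta>"
  shows "curve v (of_int i + 1 + r) = F (v (i + 1)) (v (i + 2)) r"
    and "curve v (of_int i + 1 - \<eta> + r) = F (v i) (v (i + 1)) (1 - \<eta> + r)"
  using assms eta curve_on_edge[of "i + 1" "of_int i + 1 + r"]
    curve_on_edge[of i "of_int i + 1 - \<eta> + r"]
  by (auto simp: algebra_simps)

context
  fixes v :: "int \<Rightarrow> 'v"
  assumes v: "\<And>i. distinct [v i, v (i + 1), v (i + 2)]"
begin

text \<open>As \<eta> is less than 1, a secant either stays within one edge or straddles a single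
  corner; these are the cases \<open>edge_ne\<close> and \<open>corner_ne\<close>.\<close>

lemma curve_ne: "curve v (t + \<eta>) \<noteq> curve v t"
proof (cases "t \<le> of_int \<lfloor>t\<rfloor> + (1 - \<eta>)")
  case True
  then show ?thesis
    using edge_ne[of "v \<lfloor>t\<rfloor>" "v (\<lfloor>t\<rfloor> + 1)" "t - of_int \<lfloor>t\<rfloor>"] v[of "\<lfloor>t\<rfloor>"]
    by (simp add: curve_near_edge[of "\<lfloor>t\<rfloor>"])
next
  case False
  define r where "r = t - (of_int \<lfloor>t\<rfloor> + 1 - \<eta>)"
  have r: "0 \<le> r" "r \<le> \<eta>" "t + \<eta> = of_int \<lfloor>t\<rfloor> + 1 + r" "t = of_int \<lfloor>t\<rfloor> + 1 - \<eta> + r"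
    using False by (auto simp: r_def) linarith+
  have "curve v (of_int \<lfloor>t\<rfloor> + 1 + r) \<noteq> curve v (of_int \<lfloor>t\<rfloor> + 1 - \<eta> + r)"
    unfolding curve_near_corner[OF r(1,2)] by (rule corner_ne) (use v r in auto)
  then show ?thesis by (metis r(3,4))
qed

lemma continuous_on_secant: "continuous_on S (\<lambda>t. curve v (t + \<eta>) - curve v t)"
  by (intro continuous_intros continuous_on_compose2[OF continuous_on_curve[of UNIV]]) auto

lemma turn_secant_edge:
  "turn (\<lambda>t. curve v (t + \<eta>) - curve v t) (of_int i) (of_int i + 1)
    = edge_turn (v i) (v (i + 1)) + corner_turn (v i) (v (i + 1)) (v (i + 2))"
proof -
  let ?D = "\<lambda>t. curve v (t + \<eta>) - curve v t" and ?i = "of_int i :: real"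
  have "turn ?D ?i (?i + 1) = turn ?D ?i (?i + (1 - \<eta>)) + turn ?D (?i + (1 - \<eta>)) (?i + 1)"
    using curve_ne eta by (subst turn_add) (auto intro: continuous_on_secant)
  moreover have "turn ?D (0 + ?i) (1 - \<eta> + ?i) = edge_turn (v i) (v (i + 1))"
    unfolding edge_turn_def turn_shift[symmetric]
    by (intro turn_cong) (use eta in \<open>auto simp: curve_near_edge[of i]\<close>)
  moreover have "turn ?D (0 + (?i + (1 - \<eta>))) (\<eta> + (?i + (1 - \<eta>)))
      = corner_turn (v i) (v (i + 1)) (v (i + 2))"
    unfolding corner_turn_def turn_shift[symmetric]
  proof (rule turn_cong)
    fix t assume t: "0 \<le> t" "t \<le> \<eta>"
    have "t + (?i + (1 - \<eta>)) + \<eta> = ?i + 1 + t" "t + (?i + (1 - \<eta>)) = ?i + 1 - \<eta> + t" by simp_all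
    then show "curve v (t + (?i + (1 - \<eta>)) + \<eta>) - curve v (t + (?i + (1 - \<eta>)))
        = F (v (i + 1)) (v (i + 2)) t - F (v i) (v (i + 1)) (1 - \<eta> + t)"
      by (simp only: curve_near_corner[OF t])
  qed (use eta in simp)
  ultimately show ?thesis by (simp add: add.commute)
qed

lemma turn_secant:
  "turn (\<lambda>t. curve v (t + \<eta>) - curve v t) 0 (real n)
    = (\<Sum>i<n. edge_turn (v (int i)) (v (int i + 1)) + corner_turn (v (int i)) (v (int i + 1)) (v (int i + 2)))"
proof (induction n)
  case 0
  then show ?case
    using curve_ne winding_number_constI[of "sgn (curve v \<eta> - curve v 0)" 0] curve_ne[of 0]
    by (simp add: turn_def sgn_zero_iff)
next
  case (Suc n)
  have "turn (\<lambda>t. curve v (t + \<eta>) - curve v t) 0 (real (Suc n))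
    = turn (\<lambda>t. curve v (t + \<eta>) - curve v t) 0 (real n)
      + turn (\<lambda>t. curve v (t + \<eta>) - curve v t) (real n) (real n + 1)"
    using curve_ne by (subst turn_add) (auto intro: continuous_on_secant simp: add.commute)
  then show ?case using Suc.IH turn_secant_edge[of "int n"] by simp
qed

end

end

section \<open>Graph spaces and polygons\<close>

lemma vertex_point_nth: "vertex_point u $ w = (if w = u then 1 else 0)"
  by (simp add: vertex_point_def axis_def)

lemma inj_vertex_point: "vertex_point u = vertex_point v \<longleftrightarrow> u = v"
  by (metis vertex_point_nth zero_neq_one)

lemma edge_path_nth:
  "edge_path u v t $ w = (if w = u then 1 - t else 0) + (if w = v then t else 0)"
  by (simp add: edge_path_def linepath_def vertex_point_nth)

lemma edge_path_0 [simp]: "edge_path u v 0 = vertex_point u"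
  and edge_path_1 [simp]: "edge_path u v 1 = vertex_point v"
  by (simp_all add: edge_path_def linepath_def)

lemma edge_path_rev: "edge_path v u t = edge_path u v (1 - t)"
  by (simp add: edge_path_def linepath_def)

lemma edge_path_refl: "edge_path u u t = vertex_point u"
  by (simp add: edge_path_def linepath_def scaleR_left_distrib[symmetric])

lemma continuous_on_edge_path [continuous_intros]:
  "continuous_on S h \<Longrightarrow> continuous_on S (\<lambda>t. edge_path u v (h t))"
  unfolding edge_path_def linepath_def by (intro continuous_intros)

lemma dist_edge_path: "dist (edge_path u v s) (edge_path u v t) \<le> 2 * \<bar>s - t\<bar>"
proof -
  have "edge_path u v s - edge_path u v t = (s - t) *\<^sub>R (vertex_point v - vertex_point u)"
    by (simp add: edge_path_def linepath_def algebra_simps)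
  moreover have "norm (vertex_point v - vertex_point u :: real ^ 'a) \<le> 1 + 1"
    using norm_triangle_ineq4[of "vertex_point v" "vertex_point u"] by (simp add: vertex_point_def)
  ultimately show ?thesis
    using mult_left_mono[of "norm (vertex_point v - vertex_point u :: real ^ 'a)" 2 "\<bar>s - t\<bar>"]
    by (simp add: dist_norm mult.commute)
qed

text \<open>The coordinates at the four vertices reveal edge and parameter. At parameter 0 the point
  determines the first vertex only, hence the condition \<open>0 < s\<close> for the second.\<close>

lemma edge_path_eq:
  assumes "edge_path u v s = edge_path u' v' t" "u \<noteq> v" "u' \<noteq> v'" "0 \<le> s" "s < 1" "0 \<le> t" "t < 1"
  shows "u = u' \<and> s = t \<and> (0 < s \<longrightarrow> v = v') \<or> u = v' \<and> v = u' \<and> s = 1 - t"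
proof -
  have "edge_path u v s $ w = edge_path u' v' t $ w" for w using assms(1) by simp
  from this[of u] this[of v] this[of u'] this[of v'] show ?thesis
    using assms(2-) by (auto simp: edge_path_nth split: if_splits)
qed

lemma convex_hull_edge: "convex hull (vertex_point ` {u, v}) = edge_path u v ` {0..1}"
  unfolding edge_path_def using path_image_linepath[of "vertex_point u" "vertex_point v"]
  by (simp add: path_image_def segment_convex_hull)

definition is_simple_graph :: "'v fin_graph \<Rightarrow> bool" where
  "is_simple_graph H \<longleftrightarrow> (\<forall>e\<in>snd H. card e = 2 \<and> e \<subseteq> fst H)"

lemma is_simple_graph_edgeE:
  assumes "is_simple_graph H" "e \<in> snd H"
  obtains u v where "e = {u, v}" "u \<noteq> v" "u \<in> fst H" "v \<in> fst H"
  using assms unfolding is_simple_graph_def by (metis card_2_iff insert_subset)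

lemma subgraph_complete_iff: "is_subgraph H complete_graph \<longleftrightarrow> is_simple_graph H"
  by (auto simp: is_subgraph_def complete_graph_def is_simple_graph_def)

lemma graph_space_cases:
  assumes "is_simple_graph H" "x \<in> graph_space H"
  obtains v where "v \<in> fst H" "x = vertex_point v"
  | u v t where "{u, v} \<in> snd H" "u \<noteq> v" "0 < t" "t < 1" "x = edge_path u v t"
proof -
  consider v where "v \<in> fst H" "x = vertex_point v"
    | e where "e \<in> snd H" "x \<in> convex hull (vertex_point ` e)"
    using assms(2) by (auto simp: graph_space_def)
  then show thesis
  proof cases
    case 2
    then obtain u v where uv: "e = {u, v}" "u \<noteq> v" "u \<in> fst H" "v \<in> fst H"
      using assms(1) by (elim is_simple_graph_edgeE)
    obtain t where t: "t \<in> {0..1}" "x = edge_path u v t"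
      using 2(2) unfolding uv(1) convex_hull_edge by blast
    consider "t = 0" | "t = 1" | "0 < t" "t < 1" using t(1) by fastforce
    then show ?thesis
      by cases (use t uv 2(1) that in auto)
  qed (use that in auto)
qed

lemma vertex_point_in_graph_space:
  assumes "is_simple_graph H"
  shows "vertex_point v \<in> graph_space H \<longleftrightarrow> v \<in> fst H"
proof
  assume "vertex_point v \<in> graph_space H"
  with assms show "v \<in> fst H"
  proof (cases rule: graph_space_cases)
    case (2 a b t)
    then have "vertex_point v $ v = edge_path a b t $ v" by simp
    then show ?thesis using 2(2-4) by (auto simp: vertex_point_nth edge_path_nth split: if_splits)
  qed (simp add: inj_vertex_point)
qed (auto simp: graph_space_def)

lemma edge_path_in_graph_space:
  assumes "{u, v} \<in> snd H" "0 \<le> t" "t \<le> 1"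
  shows "edge_path u v t \<in> graph_space H"
proof -
  have "edge_path u v t \<in> convex hull (vertex_point ` {u, v})"
    unfolding convex_hull_edge using assms by auto
  then show ?thesis using assms(1) unfolding graph_space_def by blast
qed

lemma edge_path_in_graph_space_iff:
  assumes "is_simple_graph H" "u \<noteq> v" "0 < t" "t < 1"
  shows "edge_path u v t \<in> graph_space H \<longleftrightarrow> {u, v} \<in> snd H"
proof
  assume "edge_path u v t \<in> graph_space H"
  with assms(1) show "{u, v} \<in> snd H"
  proof (cases rule: graph_space_cases)
    case (1 w)
    then have "edge_path u v t $ u = vertex_point w $ u" "edge_path u v t $ v = vertex_point w $ v"
      by simp_all
    then show ?thesis using assms by (auto simp: vertex_point_nth edge_path_nth split: if_splits)
  next
    case (2 a b s)
    then have "{u, v} = {a, b}"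
      using edge_path_eq[of u v t a b s] assms by auto
    then show ?thesis using 2 by simp
  qed
qed (use assms in \<open>simp add: edge_path_in_graph_space\<close>)

text \<open>Vertices are recovered from their points and edges from their midpoints.\<close>

lemma graph_space_inject:
  assumes "is_simple_graph G" "is_simple_graph H" "graph_space G = graph_space H"
  shows "G = H"
proof -
  have "fst G = fst H"
    using vertex_point_in_graph_space assms by blast
  moreover have "snd G = snd H"
  proof -
    have "snd A \<subseteq> snd B"
      if A: "is_simple_graph A" and B: "is_simple_graph B" and AB: "graph_space A = graph_space B"
      for A B :: "'a fin_graph"
    proof
      fix e assume "e \<in> snd A"
      with A obtain u v where "e = {u, v}" "u \<noteq> v" by (elim is_simple_graph_edgeE)
      then show "e \<in> snd B"
        using edge_path_in_graph_space_iff[OF A, of u v "1/2"]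
          edge_path_in_graph_space_iff[OF B, of u v "1/2"] AB \<open>e \<in> snd A\<close> by simp
    qed
    then show ?thesis using assms by blast
  qed
  ultimately show ?thesis by (simp add: prod_eq_iff)
qed

section \<open>Cyclic vertex sequences, their graphs and polygons\<close>

definition cyc_nth :: "'v list \<Rightarrow> int \<Rightarrow> 'v" where
  "cyc_nth vs i = vs ! nat (i mod int (length vs))"

definition cycle_graph :: "'v list \<Rightarrow> 'v fin_graph" where
  "cycle_graph vs = (set vs, range (\<lambda>i. {cyc_nth vs i, cyc_nth vs (i + 1)}))"

definition polygon :: "'v list \<Rightarrow> real \<Rightarrow> real ^ 'v::finite" where
  "polygon vs t = edge_path (cyc_nth vs \<lfloor>t\<rfloor>) (cyc_nth vs (\<lfloor>t\<rfloor> + 1)) (frac t)"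

lemma polygon_on_edge:
  assumes "of_int i \<le> t" "t \<le> of_int i + 1"
  shows "polygon vs t = edge_path (cyc_nth vs i) (cyc_nth vs (i + 1)) (t - of_int i)"
proof (cases "t = of_int i + 1")
  case True
  then show ?thesis by (simp add: polygon_def frac_def add.commute)
next
  case False
  then have "\<lfloor>t\<rfloor> = i" using assms by (intro floor_unique) auto
  then show ?thesis by (simp add: polygon_def frac_def)
qed

lemma continuous_on_polygon: "continuous_on S (polygon vs)"
proof -
  have "continuous_on {of_int n..of_int n + 1} (polygon vs)" for n :: int
    by (subst continuous_on_cong[OF refl polygon_on_edge]) (auto intro!: continuous_intros)
  then have "continuous_on UNIV (polygon vs)" by (rule continuous_on_unit_intervals)
  then show ?thesis by (rule continuous_on_subset) simp
qed

lemma cyc_nth_shift: "cyc_nth vs (i + int (length vs)) = cyc_nth vs i"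
  by (simp add: cyc_nth_def)

lemma polygon_shift: "polygon vs (t + of_int m * real (length vs)) = polygon vs t"
proof -
  have e: "t + of_int m * real (length vs) = t + of_int (m * int (length vs))" by simp
  have "cyc_nth vs (i + m * int (length vs)) = cyc_nth vs i" for i
    by (simp add: cyc_nth_def)
  from this[of "\<lfloor>t\<rfloor>"] this[of "\<lfloor>t\<rfloor> + 1"] show ?thesis
    unfolding polygon_def e frac_def floor_add_int by (simp add: algebra_simps)
qed

context
  fixes vs :: "'v::finite list"
  assumes vs: "distinct vs" "3 \<le> length vs"
begin

lemma cyc_nth_eq_iff: "cyc_nth vs i = cyc_nth vs j \<longleftrightarrow> int (length vs) dvd i - j"
proof -
  have "0 < int (length vs)" using vs(2) by linarith
  then have "nat (i mod int (length vs)) < length vs" for i by (simp add: nat_less_iff)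
  then have "cyc_nth vs i = cyc_nth vs j \<longleftrightarrow> nat (i mod int (length vs)) = nat (j mod int (length vs))"
    unfolding cyc_nth_def using vs(1) by (simp add: nth_eq_iff_index_eq)
  also have "\<dots> \<longleftrightarrow> i mod int (length vs) = j mod int (length vs)"
    using \<open>0 < int (length vs)\<close> by (simp add: eq_nat_nat_iff)
  finally show ?thesis by (simp add: mod_eq_dvd_iff)
qed

lemma cyc_nth_distinct: "distinct [cyc_nth vs i, cyc_nth vs (i + 1), cyc_nth vs (i + 2)]"
  using zdvd_not_zless[of 1 "int (length vs)"] zdvd_not_zless[of 2 "int (length vs)"] vs(2)
  by (simp add: cyc_nth_eq_iff)

lemma range_cyc_nth: "range (cyc_nth vs) = set vs"
proof
  show "range (cyc_nth vs) \<subseteq> set vs"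
  proof
    fix v assume "v \<in> range (cyc_nth vs)"
    then obtain i where "v = cyc_nth vs i" by blast
    moreover have "nat (i mod int (length vs)) < length vs"
      using vs(2) pos_mod_bound[of "int (length vs)" i] by linarith
    ultimately show "v \<in> set vs" by (simp add: cyc_nth_def)
  qed
  show "set vs \<subseteq> range (cyc_nth vs)"
  proof
    fix v assume "v \<in> set vs"
    then obtain n where "n < length vs" "v = vs ! n" by (metis in_set_conv_nth)
    then have "v = cyc_nth vs (int n)" by (simp add: cyc_nth_def)
    then show "v \<in> range (cyc_nth vs)" by blast
  qed
qed

lemma is_simple_graph_cycle: "is_simple_graph (cycle_graph vs)"
proof -
  have "cyc_nth vs i \<in> set vs" for i using range_cyc_nth by blast
  then show ?thesis using cyc_nth_distinct
    by (auto simp: is_simple_graph_def cycle_graph_def)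
qed

lemma polygon_eq_iff: "polygon vs s = polygon vs t \<longleftrightarrow> (s - t) / real (length vs) \<in> \<int>"
proof
  assume eq: "polygon vs s = polygon vs t"
  let ?i = "\<lfloor>s\<rfloor>" and ?j = "\<lfloor>t\<rfloor>"
  have "cyc_nth vs ?i = cyc_nth vs ?j \<and> frac s = frac t
      \<or> cyc_nth vs ?i = cyc_nth vs (?j + 1) \<and> cyc_nth vs (?i + 1) = cyc_nth vs ?j \<and> frac s = 1 - frac t"
    using edge_path_eq[OF eq[unfolded polygon_def]] cyc_nth_distinct[of ?i] cyc_nth_distinct[of ?j]
    by (auto simp: frac_lt_1)
  then show "(s - t) / real (length vs) \<in> \<int>"
  proof
    assume *: "cyc_nth vs ?i = cyc_nth vs ?j \<and> frac s = frac t"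
    then obtain m where "?i - ?j = int (length vs) * m" unfolding cyc_nth_eq_iff by blast
    moreover have "s - t = of_int (?i - ?j)" using * by (simp add: frac_def)
    ultimately have "(s - t) / real (length vs) = of_int m" using vs(2) by auto
    then show ?thesis by simp
  next
    assume "cyc_nth vs ?i = cyc_nth vs (?j + 1) \<and> cyc_nth vs (?i + 1) = cyc_nth vs ?j \<and> frac s = 1 - frac t"
    \<comment> \<open>In this case an edge would be traversed in both directions. The difference of
      the two congruences is 2, which a length of at least 3 does not divide.\<close>
    then have "int (length vs) dvd (?i + 1 - ?j) - (?i - (?j + 1))" unfolding cyc_nth_eq_iff by (metis dvd_diff)
    then have "int (length vs) dvd 2" by simp
    then show ?thesis using zdvd_not_zless[of 2 "int (length vs)"] vs(2) by simp
  qed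
next
  assume "(s - t) / real (length vs) \<in> \<int>"
  then obtain m where "(s - t) / real (length vs) = of_int m" by (auto elim: Ints_cases)
  moreover have "real (length vs) \<noteq> 0" using vs(2) by auto
  ultimately have "s = t + of_int m * real (length vs)" by (simp add: field_simps)
  then show "polygon vs s = polygon vs t" by (simp only: polygon_shift)
qed

lemma range_polygon: "range (polygon vs) = graph_space (cycle_graph vs)"
proof
  show "range (polygon vs) \<subseteq> graph_space (cycle_graph vs)"
    unfolding polygon_def
    by (auto intro!: edge_path_in_graph_space simp: cycle_graph_def less_imp_le[OF frac_lt_1])
  show "graph_space (cycle_graph vs) \<subseteq> range (polygon vs)"
  proof
    fix x assume "x \<in> graph_space (cycle_graph vs)"
    then consider i where "x = vertex_point (cyc_nth vs i)"
      | i where "x \<in> convex hull (vertex_point ` {cyc_nth vs i, cyc_nth vs (i + 1)})"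
      unfolding graph_space_def cycle_graph_def fst_conv snd_conv range_cyc_nth[symmetric] by blast
    then obtain i t where "t \<in> {0..1}" "x = edge_path (cyc_nth vs i) (cyc_nth vs (i + 1)) t"
      unfolding convex_hull_edge by cases (force, blast)
    then have "x = polygon vs (of_int i + t)" using polygon_on_edge[of i "of_int i + t" vs] by simp
    then show "x \<in> range (polygon vs)" by blast
  qed
qed

lemma parametrizes_polygon: "parametrizes (\<lambda>t. polygon vs (real (length vs) * t)) (cycle_graph vs)"
proof -
  let ?q = "\<lambda>t. polygon vs (real (length vs) * t)"
  have k: "real (length vs) > 0" using vs(2) by linarith
  have q: "?q s = ?q t \<longleftrightarrow> s - t \<in> \<int>" for s t
    using k by (simp add: polygon_eq_iff right_diff_distrib[symmetric])
  have "path ?q" unfolding path_def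
    by (intro continuous_on_compose2[OF continuous_on_polygon[of UNIV]] continuous_intros) auto
  moreover have "loop_free ?q"
    unfolding loop_free_def q
  proof (intro ballI impI)
    fix x y :: real assume xy: "x \<in> {0..1}" "y \<in> {0..1}" "x - y \<in> \<int>"
    then obtain m where m: "x - y = of_int m" by (auto elim: Ints_cases)
    then have "-1 \<le> m" "m \<le> 1" using xy by auto
    then have "m = -1 \<or> m = 0 \<or> m = 1" by linarith
    then show "x = y \<or> x = 0 \<and> y = 1 \<or> x = 1 \<and> y = 0" using m xy by auto
  qed
  moreover have "?q 1 = ?q 0" by (subst q) simp
  moreover have "path_image ?q = range (polygon vs)"
  proof
    show "range (polygon vs) \<subseteq> path_image ?q"
    proof
      fix x assume "x \<in> range (polygon vs)"
      then obtain t where t: "x = polygon vs t" by blast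
      have "?q (t / real (length vs)) = ?q (frac (t / real (length vs)))"
        by (subst q) (simp add: frac_def)
      then have "x = ?q (frac (t / real (length vs)))" using t k by simp
      then show "x \<in> path_image ?q" by (auto simp: path_image_def less_imp_le[OF frac_lt_1])
    qed
  qed (auto simp: path_image_def)
  ultimately show ?thesis
    by (simp add: parametrizes_def simple_path_def pathfinish_def pathstart_def range_polygon)
qed

lemma cycle_graph_in_cycles: "cycle_graph vs \<in> cycles complete_graph"
  using homeomorphic_simple_path_image_circle[of "\<lambda>t. polygon vs (real (length vs) * t)" 1 "0::complex"]
    parametrizes_polygon is_simple_graph_cycle
  by (simp add: cycles_def parametrizes_def subgraph_complete_iff)

end

section \<open>Images of simple loops\<close>

text \<open>The notion is phrased by a parametrisation instead of a homeomorphism because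
  parametrisations of the cycles are what the theorem is given.\<close>

definition simple_loop_image :: "'a::topological_space set \<Rightarrow> bool" where
  "simple_loop_image S \<longleftrightarrow> (\<exists>p. simple_path p \<and> pathfinish p = pathstart p \<and> path_image p = S)"

lemma simple_loop_image_based:
  assumes "simple_loop_image S" "x \<in> S"
  obtains p where "simple_path p" "pathstart p = x" "pathfinish p = x" "path_image p = S"
proof -
  obtain p where p: "simple_path p" "pathfinish p = pathstart p" "path_image p = S"
    using assms(1) unfolding simple_loop_image_def by blast
  obtain a where a: "a \<in> {0..1}" "x = p a" using assms(2) p(3) by (auto simp: path_image_def)
  show thesis
    by (rule that[of "shiftpath a p"])
       (use p a in \<open>auto simp: simple_path_shiftpath pathstart_shiftpath pathfinish_shiftpath
           path_image_shiftpath\<close>)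
qed

lemma simple_loop_image_minus_point:
  assumes "simple_loop_image S" "x \<in> S"
  obtains p where "simple_path p" "path_image p = S" "S - {x} = p ` {0<..<1}" "connected (S - {x})"
    "continuous_on {0..1} p" "inj_on p {0<..<1}" "p 0 = x" "p 1 = x"
proof -
  obtain p where p: "simple_path p" "pathstart p = x" "pathfinish p = x" "path_image p = S"
    using simple_loop_image_based[OF assms] .
  then have "inj_on p {0<..<1}"
    by (intro inj_onI) (force simp: simple_path_def loop_free_def)
  then show thesis
    using that[of p] p simple_path_endless[of p] connected_simple_path_endless[of p]
    by (auto simp: simple_path_def path_def pathstart_def pathfinish_def)
qed

lemma infinite_simple_loop_image:
  assumes "simple_loop_image S"
  shows "infinite S"
proof
  assume "finite S"
  obtain x where "x \<in> S" 
    using assms path_image_nonempty unfolding simple_loop_image_def by fastforce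
  obtain p where p: "simple_path p" "path_image p = S" "S - {x} = p ` {0<..<1}" "connected (S - {x})"
    "continuous_on {0..1} p" "inj_on p {0<..<1}" "p 0 = x" "p 1 = x"
    using simple_loop_image_minus_point[OF assms \<open>x \<in> S\<close>] .
  have "finite (p ` {0<..<1})" using \<open>finite S\<close> p(3) by (metis finite_Diff)
  then show False using finite_imageD[OF _ p(6)] infinite_Ioo[of "0::real" 1] by simp
qed

text \<open>If \<open>T\<close> missed a point of \<open>S\<close>, it would lie in \<open>S\<close>
  without that point, which is an open arc, and could be pulled back injectively to an
  interval.\<close>

lemma simple_loop_image_subset_imp_eq:
  fixes S T :: "'a::euclidean_space set"
  assumes S: "simple_loop_image S" and T: "simple_loop_image T" and "T \<subseteq> S"
  shows "T = S"
proof (rule ccontr)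
  assume "T \<noteq> S"
  then obtain x where x: "x \<in> S" "x \<notin> T" using \<open>T \<subseteq> S\<close> by blast
  obtain p where p: "simple_path p" "path_image p = S" "S - {x} = p ` {0<..<1}" "connected (S - {x})"
    "continuous_on {0..1} p" "inj_on p {0<..<1}" "p 0 = x" "p 1 = x"
    using simple_loop_image_minus_point[OF S x(1)] .
  have p_T: "\<exists>t\<in>{0<..<1}. p t = y" if "y \<in> T" for y
  proof -
    have "y \<in> S - {x}" using that x(2) \<open>T \<subseteq> S\<close> by blast
    then show ?thesis unfolding p(3) by blast
  qed
  define g where "g = inv_into {0<..<1} p"
  have g: "g y \<in> {0<..<1}" "p (g y) = y" if "y \<in> T" for y
  proof -
    have "y \<in> p ` {0<..<1}" using p_T[OF that] by blast
    then show "g y \<in> {0<..<1}" "p (g y) = y" unfolding g_def by (rule inv_into_into, rule f_inv_into_f)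
  qed
  obtain q where q: "simple_path q" "pathfinish q = pathstart q" "path_image q = T"
    using T unfolding simple_loop_image_def by blast
  have "compact T" using q compact_simple_path_image by auto
  \<comment> \<open>The ends of \<open>p\<close> are mapped to \<open>x\<close>, outside
    \<open>T\<close>, so this compact preimage lies in the open interval, where \<open>p\<close> is
    injective; compactness then makes the inverse continuous on \<open>T\<close>.\<close>
  define K where "K = {0..1} \<inter> p -` T"
  have ends: "p 0 \<notin> T" "p 1 \<notin> T" using p(7,8) x(2) by auto
  have "closed K"
    unfolding K_def using p(5) compact_imp_closed[OF \<open>compact T\<close>] by (intro continuous_closed_preimage) auto
  moreover have "bounded K" by (rule bounded_subset[of "{0..1}"]) (auto simp: K_def)
  ultimately have "compact K" by (simp add: compact_eq_bounded_closed)
  have K: "K \<subseteq> {0<..<1}" "p ` K = T"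
  proof -
    show "K \<subseteq> {0<..<1}" using ends by (auto simp: K_def less_le)
    show "p ` K = T"
    proof
      show "T \<subseteq> p ` K"
      proof
        fix y assume "y \<in> T"
        then show "y \<in> p ` K" using g[of y] by (intro image_eqI[of _ _ "g y"]) (auto simp: K_def)
      qed
    qed (auto simp: K_def)
  qed
  have "continuous_on (p ` K) g"
  proof (rule continuous_on_inv)
    show "continuous_on K p" using p(5) by (rule continuous_on_subset) (auto simp: K_def)
    show "\<forall>t\<in>K. g (p t) = t" using K(1) p(6) by (auto simp: g_def intro!: inv_into_f_f)
  qed fact
  then have "continuous_on T g" by (simp add: K(2))
  define u where "u = g \<circ> q"
  have cont_u: "continuous_on {0..1} u"
    unfolding u_def
  proof (rule continuous_on_compose)
    show "continuous_on {0..1} q" using q(1) by (simp add: simple_path_def path_def)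
    show "continuous_on (q ` {0..1}) g"
      using \<open>continuous_on T g\<close> q(3) by (simp add: path_image_def)
  qed
  have u_eq: "q s = q t" if "u s = u t" "s \<in> {0..1}" "t \<in> {0..1}" for s t
  proof -
    have "q s \<in> T" "q t \<in> T" unfolding q(3)[symmetric] path_image_def using that(2,3) by blast+
    then have "p (g (q s)) = q s" "p (g (q t)) = q t" by (auto intro: g(2))
    moreover have "g (q s) = g (q t)" using that(1) by (simp add: u_def)
    ultimately show ?thesis by metis
  qed
  \<comment> \<open>\<open>u\<close> embeds a circle in the line, against the intermediate value theorem.\<close>
  have inj: "s = t \<or> s = 0 \<and> t = 1 \<or> s = 1 \<and> t = 0" if "u s = u t" "s \<in> {0..1}" "t \<in> {0..1}" for s t
    using u_eq[OF that] that q(1) unfolding simple_path_def loop_free_def by blast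
  have "u 0 = u 1" using q(2) by (simp add: u_def pathstart_def pathfinish_def)
  \<comment> \<open>Both halves of the loop join \<open>u 0\<close> and \<open>u (1/2)\<close>, so
    both attain the midpoint. By injectivity this happens at 1/2 or at the ends of the loop, which
    forces \<open>u 0 = u (1/2)\<close>.\<close>
  let ?y = "midpoint (u 0) (u (1/2))"
  have "?y \<in> u ` {a..b}" if "{u 0, u (1/2)} \<subseteq> u ` {a..b}" "{a..b} \<subseteq> {0..1}" for a b
  proof -
    have "convex (u ` {a..b})"
      using connected_continuous_image[OF continuous_on_subset[OF cont_u that(2)]]
      by (simp add: connected_convex_1)
    then have "closed_segment (u 0) (u (1/2)) \<subseteq> u ` {a..b}"
      using that(1) by (intro closed_segment_subset) auto
    then show ?thesis using midpoint_in_closed_segment by blast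
  qed
  note y_mem = this
  have "{u 0, u (1/2)} \<subseteq> u ` {0..1/2}" "{u 0, u (1/2)} \<subseteq> u ` {1/2..1}"
    unfolding \<open>u 0 = u 1\<close> using image_eqI[of "u 1" u 0] \<open>u 0 = u 1\<close> by auto
  then have "?y \<in> u ` {0..1/2}" "?y \<in> u ` {1/2..1}" by (auto intro!: y_mem)
  then obtain s t where st: "s \<in> {0..1/2}" "u s = ?y" "t \<in> {1/2..1}" "u t = ?y"
    by (auto simp del: atLeastAtMost_iff elim!: imageE)
  then have "s = 1/2 \<and> t = 1/2 \<or> s = 0"
    using inj[of s t] by auto
  then have "u (1/2) = ?y \<or> u 0 = ?y" using st by metis
  then have "u 0 = u (1/2)" by (auto simp: midpoint_def)
  then show False using inj[of 0 "1/2"] by simp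
qed

section \<open>The cycles of the complete graph on four vertices\<close>

lemma simple_loop_cycle_graph:
  "distinct vs \<Longrightarrow> 3 \<le> length vs \<Longrightarrow> simple_loop_image (graph_space (cycle_graph vs))"
  using parametrizes_polygon unfolding simple_loop_image_def parametrizes_def by blast

lemma simple_loop_graph_degree:
  fixes H :: "'v::finite fin_graph"
  assumes H: "is_simple_graph H" and loop: "simple_loop_image (graph_space H)" and v: "v \<in> fst H"
  obtains u w where "u \<noteq> w" "{v, u} \<in> snd H" "{v, w} \<in> snd H"
proof (rule ccontr)
  assume "\<not> thesis"
  with that have uniq: "\<And>u w. {v, u} \<in> snd H \<Longrightarrow> {v, w} \<in> snd H \<Longrightarrow> u = w" by blast
  have edge_in: "a \<in> fst H" "b \<in> fst H" "a \<noteq> b" if "{a, b} \<in> snd H" for a b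
    using H that unfolding is_simple_graph_def by (auto simp: card_insert_if split: if_splits)
  let ?S = "graph_space H"
  have "?S \<noteq> {vertex_point v}" using infinite_simple_loop_image[OF loop] by auto
  moreover have "vertex_point v \<in> ?S" using v H by (simp add: vertex_point_in_graph_space)
  ultimately obtain x where "x \<in> ?S" "x \<noteq> vertex_point v" by blast
  with H have "\<exists>w\<in>fst H. w \<noteq> v"
  proof (cases rule: graph_space_cases)
    case (2 a b t)
    then show ?thesis using edge_in[of a b] by (cases "a = v") auto
  qed auto
  then obtain w where w: "w \<in> fst H" "w \<noteq> v" by blast
  \<comment> \<open>If \<open>v\<close> has no neighbour, \<open>w\<close> serves as
    \<open>u\<close>; the point \<open>m\<close> below then is not in the graph at all, which does
    no harm.\<close>
  obtain u where u: "u \<noteq> v" "\<And>z. {v, z} \<in> snd H \<Longrightarrow> z = u"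
  proof (cases "\<exists>u. {v, u} \<in> snd H")
    case True
    then obtain u where "{v, u} \<in> snd H" by blast
    then show thesis using that[of u] uniq edge_in[of v u] by blast
  next
    case False
    then show thesis using that[of w] w by blast
  qed
  \<comment> \<open>Removing \<open>m\<close> separates \<open>v\<close> from \<open>w\<close>, while a circle without a point is connected.\<close>
  define m where "m = edge_path v u (1/2)"
  have "connected (?S - {m})"
  proof (cases "m \<in> ?S")
    case True
    then show ?thesis using simple_loop_image_minus_point[OF loop] by blast
  next
    case False
    moreover have "connected ?S"
      using loop connected_simple_path_image unfolding simple_loop_image_def by metis
    ultimately show ?thesis by simp
  qed
  \<comment> \<open>The coordinate at \<open>v\<close> is 1 at the point of \<open>v\<close> and 0
    at that of \<open>w\<close>. In the graph it equals 1/2 at midpoints of edges at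
    \<open>v\<close> only, and \<open>m\<close> is the only candidate.\<close>
  then have "connected ((\<lambda>x. x $ v) ` (?S - {m}))"
    by (intro connected_continuous_image continuous_intros)
  moreover have "vertex_point a \<in> ?S - {m}" if "a \<in> fst H" for a
  proof -
    have "m $ v = 1/2" using u(1) by (simp add: m_def edge_path_nth)
    then have "m \<noteq> vertex_point a" by (auto simp: vertex_point_nth split: if_splits)
    then show ?thesis using that H by (auto simp: vertex_point_in_graph_space)
  qed
  then have "vertex_point v $ v \<in> (\<lambda>x. x $ v) ` (?S - {m})"
    "vertex_point w $ v \<in> (\<lambda>x. x $ v) ` (?S - {m})"
    using v w by blast+
  then have "1 \<in> (\<lambda>x. x $ v) ` (?S - {m})" "0 \<in> (\<lambda>x. x $ v) ` (?S - {m})"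
    using w(2) by (simp_all add: vertex_point_nth)
  ultimately have "1/2 \<in> (\<lambda>x. x $ v) ` (?S - {m})"
    using connectedD_interval[of "(\<lambda>x. x $ v) ` (?S - {m})" 0 1 "1/2"] by simp
  then obtain x where "x \<in> ?S - {m}" "1/2 = x $ v" by (rule imageE)
  then have x: "x \<in> ?S" "x \<noteq> m" "x $ v = 1/2" by auto
  from H x(1) show False
  proof (cases rule: graph_space_cases)
    case (1 a)
    then show ?thesis using x(3) by (auto simp: vertex_point_nth split: if_splits)
  next
    case (2 a b t)
    then have "a = v \<and> t = 1/2 \<or> b = v \<and> t = 1/2"
      using x(3) by (auto simp: edge_path_nth split: if_splits)
    then show ?thesis
    proof
      assume *: "a = v \<and> t = 1/2"
      then have "b = u" using u(2)[of b] 2(1) by blast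
      then show False using * 2(5) x(2) unfolding m_def by metis
    next
      assume *: "b = v \<and> t = 1/2"
      then have "a = u" using u(2)[of a] 2(1) by (metis insert_commute)
      moreover have "edge_path v u (1/2) = edge_path u v (1/2)" using edge_path_rev[of u v "1/2"] by simp
      ultimately show False using * 2(5) x(2) unfolding m_def by metis
    qed
  qed
qed

lemma cycle_graph_3:
  "cycle_graph [a, b, c] = ({a, b, c}, {{a, b}, {b, c}, {c, a}})"
proof -
  have "range (\<lambda>i. {cyc_nth [a, b, c] i, cyc_nth [a, b, c] (i + 1)})
      = (\<lambda>i. {cyc_nth [a, b, c] i, cyc_nth [a, b, c] (i + 1)}) ` {0, 1, 2}" (is "range ?e = _")
  proof -
    have "?e i = ?e (i mod 3)" "i mod 3 \<in> {0, 1, 2}" for i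
      by (auto simp: cyc_nth_def mod_simps)
    then show ?thesis by blast
  qed
  then show ?thesis by (simp add: cycle_graph_def cyc_nth_def nth_Cons')
qed

lemma cycle_graph_4:
  "cycle_graph [a, b, c, d] = ({a, b, c, d}, {{a, b}, {b, c}, {c, d}, {d, a}})"
proof -
  have "range (\<lambda>i. {cyc_nth [a, b, c, d] i, cyc_nth [a, b, c, d] (i + 1)})
      = (\<lambda>i. {cyc_nth [a, b, c, d] i, cyc_nth [a, b, c, d] (i + 1)}) ` {0, 1, 2, 3}" (is "range ?e = _")
  proof -
    have "?e i = ?e (i mod 4)" "i mod 4 \<in> {0, 1, 2, 3}" for i
      by (auto simp: cyc_nth_def mod_simps)
    then show ?thesis by blast
  qed
  then show ?thesis by (simp add: cycle_graph_def cyc_nth_def nth_Cons')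
qed

text \<open>Four triangles and three squares, each listed once up to rotation and reversal; a square
  is determined by the vertex opposite to \<open>a\<close>, here \<open>c\<close>, \<open>d\<close>
  and \<open>b\<close> in turn.\<close>

definition K4_cycles :: "'v \<Rightarrow> 'v \<Rightarrow> 'v \<Rightarrow> 'v \<Rightarrow> 'v list list" where
  "K4_cycles a b c d = [[a, b, c], [a, b, d], [a, c, d], [b, c, d], [a, b, c, d], [a, b, d, c], [a, c, b, d]]"

lemma distinct_K4_cycles:
  fixes a b c d :: 'v
  assumes "distinct [a, b, c, d]"
  shows "distinct (map cycle_graph (K4_cycles a b c d))"
proof -
  \<comment> \<open>The seven lists of memberships of the six possible edges are pairwise
    different.\<close>
  define sig where "sig = (\<lambda>G :: 'v fin_graph. map (\<lambda>e. e \<in> snd G) [{a, b}, {a, c}, {a, d}, {b, c}, {b, d}, {c, d}])"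
  have "distinct (map sig (map cycle_graph (K4_cycles a b c d)))"
    using assms by (simp add: K4_cycles_def cycle_graph_3 cycle_graph_4 sig_def doubleton_eq_iff) auto
  then show ?thesis by (auto simp: distinct_map intro: inj_on_imageI2)
qed

text \<open>All degrees in a cycle are at least two, and on at most four vertices this forces a
  triangle or a four-cycle inside it; a loop contained in a loop is all of it. The assumption
  \<open>loops\<close> will follow from the given parametrisations.\<close>

lemma cycles_complete_graph_K4:
  fixes a b c d :: "'v::finite"
  assumes abcd: "distinct [a, b, c, d]" "UNIV = {a, b, c, d}"
    and loops: "\<And>\<gamma>. \<gamma> \<in> cycles (complete_graph :: 'v fin_graph) \<Longrightarrow> simple_loop_image (graph_space \<gamma>)"
  shows "cycles complete_graph = set (map cycle_graph (K4_cycles a b c d))"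
proof
  have vs: "distinct vs" "3 \<le> length vs" if "vs \<in> set (K4_cycles a b c d)" for vs
    using that abcd(1) by (auto simp: K4_cycles_def)
  show "set (map cycle_graph (K4_cycles a b c d)) \<subseteq> cycles complete_graph"
    unfolding set_map by (rule image_subsetI) (intro cycle_graph_in_cycles vs)
  show "cycles complete_graph \<subseteq> set (map cycle_graph (K4_cycles a b c d))"
  proof
    fix H :: "'v fin_graph" assume "H \<in> cycles complete_graph"
    then have H: "is_simple_graph H" and loop: "simple_loop_image (graph_space H)"
      using loops by (auto simp: cycles_def subgraph_complete_iff)
    have E_fst: "x \<in> fst H \<and> y \<in> fst H \<and> x \<noteq> y" if "{x, y} \<in> snd H" for x y
      using H that unfolding is_simple_graph_def by (auto simp: card_insert_if split: if_splits)
    have deg: "\<exists>u w. u \<noteq> w \<and> {x, u} \<in> snd H \<and> {x, w} \<in> snd H" if "x \<in> fst H" for x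
      using simple_loop_graph_degree[OF H loop that] by metis
    obtain x where "x \<in> fst H"
    proof -
      obtain y where "y \<in> graph_space H" using infinite_simple_loop_image[OF loop] by fastforce
      with H show thesis by (cases rule: graph_space_cases) (use that E_fst in blast)+
    qed
    have deg': "{x, u} \<in> snd H \<and> {x, v} \<in> snd H \<or> {x, u} \<in> snd H \<and> {x, w} \<in> snd H
        \<or> {x, v} \<in> snd H \<and> {x, w} \<in> snd H"
      if x: "x \<in> fst H" and U: "UNIV = {x, u, v, w}" for x u v w
    proof -
      obtain y z where yz: "y \<noteq> z" "{x, y} \<in> snd H" "{x, z} \<in> snd H" using deg[OF x] by blast
      moreover have "y \<in> {x, u, v, w}" "z \<in> {x, u, v, w}" using U by blast+
      moreover have "y \<noteq> x" "z \<noteq> x" using E_fst yz by blast+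
      ultimately show ?thesis by auto
    qed
    have "x \<in> {a, b, c, d}" using abcd(2) by blast
    with \<open>x \<in> fst H\<close> have "a \<in> fst H \<or> b \<in> fst H \<or> c \<in> fst H \<or> d \<in> fst H" by blast
    moreover have "UNIV = {b, a, c, d}" "UNIV = {c, a, b, d}" "UNIV = {d, a, b, c}"
      using abcd(2) by auto
    note deg'[OF _ abcd(2)] deg'[OF _ this(1)] deg'[OF _ this(2)] deg'[OF _ this(3)]
    moreover note E_fst[of a b] E_fst[of a c] E_fst[of a d] E_fst[of b c] E_fst[of b d] E_fst[of c d]
    \<comment> \<open>What remains is propositional, in the presence of six edges and four vertices:
      every vertex present has at least two of its three possible edges.\<close>
    ultimately have "\<exists>vs\<in>set (K4_cycles a b c d). snd (cycle_graph vs) \<subseteq> snd H"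
      by (simp add: K4_cycles_def cycle_graph_3 cycle_graph_4 insert_commute) argo
    then obtain vs where vs': "vs \<in> set (K4_cycles a b c d)" "snd (cycle_graph vs) \<subseteq> snd H" by blast
    have "set vs \<subseteq> fst H"
    proof
      fix v assume "v \<in> set vs"
      then obtain i where "v = cyc_nth vs i" using range_cyc_nth[OF vs[OF vs'(1)]] by blast
      then have "{v, cyc_nth vs (i + 1)} \<in> snd H" using vs'(2) by (auto simp: cycle_graph_def)
      then show "v \<in> fst H" using E_fst by blast
    qed
    then have "fst (cycle_graph vs) \<subseteq> fst H" by (simp add: cycle_graph_def)
    then have "graph_space (cycle_graph vs) \<subseteq> graph_space H"
      using vs'(2) unfolding graph_space_def by (intro Un_mono image_mono UN_mono) auto
    then have "graph_space (cycle_graph vs) = graph_space H"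
      using simple_loop_image_subset_imp_eq[OF loop] simple_loop_cycle_graph vs[OF vs'(1)] by blast
    then have "cycle_graph vs = H"
      using graph_space_inject is_simple_graph_cycle vs[OF vs'(1)] H by blast
    then show "H \<in> set (map cycle_graph (K4_cycles a b c d))" using vs'(1) by auto
  qed
qed

section \<open>Parity of the rotation numbers\<close>

context immersed_complete_graph
begin

lemma curve_uminus: "curve (\<lambda>i. v (- i)) t = curve v (- t)"
proof -
  let ?i = "\<lfloor>t\<rfloor>"
  \<comment> \<open>This index is right for integral \<open>t\<close> as well: \<open>- t\<close> is
    then the final point of the edge with index \<open>- \<lfloor>t\<rfloor> - 1\<close>.\<close>
  have "curve v (- t) = F (v (- ?i - 1)) (v (- ?i - 1 + 1)) (- t - of_int (- ?i - 1))"
    by (rule curve_on_edge) linarith+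
  also have "\<dots> = F (v (- ?i)) (v (- ?i - 1)) (frac t)"
    using F_rev[of "v (- ?i)" "v (- ?i - 1)" "frac t"] by (simp add: frac_def algebra_simps)
  finally show ?thesis by (simp add: curve_def)
qed

lemma triangle_defect_cyclic: "triangle_defect b c a = triangle_defect a b c"
  by (simp add: triangle_defect_def)

text \<open>Rotation exchanges the two edges in one of the opposite defects, which reverses its
  sign; hence the claim concerns the parity only.\<close>

lemma square_defect_cyclic:
  assumes "distinct [a, b, c, d]"
  shows "even (square_defect b c d a - square_defect a b c d)"
  using opposite_defect_swap[OF assms] by (simp add: square_defect_def)

end

section \<open>From generic immersions to nonvanishing secants\<close>

lemma plane_generic_immersion_vertex:
  fixes f :: "real ^ 'v::finite \<Rightarrow> complex"
  assumes f: "plane_generic_immersion complete_graph f"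
    and x: "x \<in> graph_space complete_graph" "f x = f (vertex_point v)"
  shows "x = vertex_point v"
proof (rule ccontr)
  assume ne: "x \<noteq> vertex_point v"
  have simple: "is_simple_graph (complete_graph :: 'v fin_graph)"
    by (simp add: is_simple_graph_def complete_graph_def)
  then have v: "vertex_point v \<in> graph_space (complete_graph :: 'v fin_graph)"
    by (simp add: vertex_point_in_graph_space complete_graph_def)
  then have "f (vertex_point v) \<in> multiple_values complete_graph f"
    using x ne unfolding multiple_values_def by blast
  then have "transversal_double_point complete_graph f (f (vertex_point v))"
    using f unfolding plane_generic_immersion_def by blast
  then obtain u w s u' w' s' where uw: "{u, w} \<in> snd complete_graph" "{u', w'} \<in> snd complete_graph"
    "0 < s" "s < 1" "0 < s'" "s' < 1"
    "{x \<in> graph_space complete_graph. f x = f (vertex_point v)} = {edge_path u w s, edge_path u' w' s'}"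
    unfolding transversal_double_point_def by metis
  \<comment> \<open>A double point has only interior points of edges as preimages, while the vertex
    itself is a preimage of the value in question.\<close>
  then have "vertex_point v \<in> {edge_path u w s, edge_path u' w' s'}" using v by blast
  moreover have "vertex_point v \<noteq> edge_path a b t" if "{a, b} \<in> snd complete_graph" "0 < t" "t < 1" for a b :: 'v and t
  proof
    assume "vertex_point v = edge_path a b t"
    then have "edge_path a b t $ v = 1" by (metis vertex_point_nth)
    moreover have "a \<noteq> b" using that(1) by (auto simp: complete_graph_def)
    ultimately show False using that(2,3) by (auto simp: edge_path_nth split: if_splits)
  qed
  ultimately show False using uw by blast
qed

lemma compact_graph_space:
  fixes G :: "'v::finite fin_graph"
  shows "compact (graph_space G)"
proof -
  have "compact (vertex_point ` fst G)" by (intro finite_imp_compact finite_imageI) simp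
  moreover have "compact (\<Union>e\<in>snd G. convex hull (vertex_point ` e :: (real ^ 'v) set))"
    by (intro compact_UN compact_convex_hull finite_imp_compact finite_imageI) simp_all
  ultimately show ?thesis unfolding graph_space_def by (rule compact_Un)
qed

text \<open>\<delta> is a Lebesgue number for the cover of the compact graph by open sets on which
  \<open>f\<close> is injective.\<close>

lemma immersion_uniformly_locally_injective:
  assumes "immersion G f"
  obtains \<delta> where "0 < \<delta>"
    "\<And>x y. x \<in> graph_space G \<Longrightarrow> y \<in> graph_space G \<Longrightarrow> x \<noteq> y \<Longrightarrow> dist x y < \<delta> \<Longrightarrow> f x \<noteq> f y"
proof -
  let ?U = "{U. open U \<and> inj_on f (graph_space G \<inter> U)}"
  have "graph_space G \<subseteq> \<Union>?U" using assms unfolding immersion_def by blast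
  then obtain \<delta> where \<delta>: "0 < \<delta>" "\<And>x. x \<in> graph_space G \<Longrightarrow> \<exists>U\<in>?U. ball x \<delta> \<subseteq> U"
    by (rule Heine_Borel_lemma[OF compact_graph_space]) blast+
  show thesis
  proof (rule that[OF \<delta>(1)])
    fix x y assume xy: "x \<in> graph_space G" "y \<in> graph_space G" "x \<noteq> y" "dist x y < \<delta>"
    then obtain U where "inj_on f (graph_space G \<inter> U)" "ball x \<delta> \<subseteq> U" using \<delta>(2) by blast
    moreover have "x \<in> ball x \<delta>" "y \<in> ball x \<delta>" using xy \<delta>(1) by auto
    ultimately show "f x \<noteq> f y" using xy by (auto dest!: inj_onD)
  qed
qed

lemma plane_generic_immersion_immersed_complete_graph:
  fixes f :: "real ^ 'v::finite \<Rightarrow> complex"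
  assumes f: "plane_generic_immersion complete_graph f"
  obtains \<delta> where "0 < \<delta>" "\<And>\<eta>. 0 < \<eta> \<Longrightarrow> \<eta> < \<delta>
    \<Longrightarrow> immersed_complete_graph (\<lambda>a b t. f (edge_path a b t)) (\<lambda>v. f (vertex_point v)) \<eta>"
proof -
  let ?S = "graph_space (complete_graph :: 'v fin_graph)"
  have imm: "immersion complete_graph f" using f by (simp add: plane_generic_immersion_def)
  obtain \<delta> where \<delta>: "0 < \<delta>"
    "\<And>x y. x \<in> ?S \<Longrightarrow> y \<in> ?S \<Longrightarrow> x \<noteq> y \<Longrightarrow> dist x y < \<delta> \<Longrightarrow> f x \<noteq> f y"
    using immersion_uniformly_locally_injective[OF imm] by blast
  have S: "edge_path a b t \<in> ?S" if "0 \<le> t" "t \<le> 1" for a b :: 'v and t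
  proof (cases "a = b")
    case True
    then show ?thesis by (auto simp: edge_path_refl graph_space_def complete_graph_def)
  next
    case False
    then show ?thesis using that by (intro edge_path_in_graph_space) (auto simp: complete_graph_def)
  qed
  have vertex: "f (edge_path a b t) \<noteq> f (vertex_point c)"
    if "edge_path a b t \<noteq> vertex_point c" "0 \<le> t" "t \<le> 1" for a b c t
    using plane_generic_immersion_vertex[OF f S] that by blast
  show thesis
  \<comment> \<open>An edge path is Lipschitz with constant 2, so the points of a secant with lag
    \<eta> are at most \<open>2 * \<eta>\<close> apart. The bound 1 ensures that a lag is shorter
    than an edge.\<close>
  proof (rule that[of "min 1 (\<delta> / 2)"])
    fix \<eta> :: real assume "0 < \<eta>" "\<eta> < min 1 (\<delta> / 2)"
    then have \<eta>: "0 < \<eta>" "\<eta> < 1" "2 * \<eta> < \<delta>" by auto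
    show "immersed_complete_graph (\<lambda>a b t. f (edge_path a b t)) (\<lambda>v. f (vertex_point v)) \<eta>"
    proof
      show "0 < \<eta>" "\<eta> < 1" by fact+
      show "f (edge_path a b 0) = f (vertex_point a)" for a b by simp
      show "f (edge_path b a t) = f (edge_path a b (1 - t))" for a b t by (simp add: edge_path_rev[of b a])
      show "continuous_on {0..1} (\<lambda>t. f (edge_path a b t))" for a b
        using imm S unfolding immersion_def
        by (auto intro!: continuous_on_compose2[of ?S f] continuous_intros)
    next
      fix a b :: 'v and t :: real assume "a \<noteq> b" "0 < t" "t \<le> 1"
      then have "edge_path a b t $ a \<noteq> vertex_point a $ a" by (simp add: edge_path_nth vertex_point_nth)
      then have "edge_path a b t \<noteq> vertex_point a" by metis
      then show "f (edge_path a b t) \<noteq> f (vertex_point a)" using \<open>0 < t\<close> \<open>t \<le> 1\<close> by (intro vertex) auto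
    next
      fix a b c :: 'v and t :: real assume "distinct [a, b, c]" "0 \<le> t" "t \<le> 1"
      then have "edge_path a b t $ c \<noteq> vertex_point c $ c" by (auto simp: edge_path_nth vertex_point_nth)
      then have "edge_path a b t \<noteq> vertex_point c" by metis
      then show "f (edge_path a b t) \<noteq> f (vertex_point c)" using \<open>0 \<le> t\<close> \<open>t \<le> 1\<close> by (intro vertex) auto
    next
      fix a b :: 'v and t :: real assume t: "a \<noteq> b" "0 \<le> t" "t + \<eta> \<le> 1"
      then have "edge_path a b (t + \<eta>) $ b \<noteq> edge_path a b t $ b" using \<eta> by (simp add: edge_path_nth)
      then have "edge_path a b (t + \<eta>) \<noteq> edge_path a b t" by metis
      moreover have "dist (edge_path a b (t + \<eta>)) (edge_path a b t) < \<delta>"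
        using dist_edge_path[of a b "t + \<eta>" t] \<eta> by simp
      ultimately show "f (edge_path a b (t + \<eta>)) \<noteq> f (edge_path a b t)"
        using t \<eta> by (intro \<delta>(2) S) auto
    next
      fix a b c :: 'v and t :: real assume t: "distinct [a, b, c]" "0 \<le> t" "t \<le> \<eta>"
      have "edge_path b c t \<noteq> edge_path a b (1 - \<eta> + t)"
      proof
        assume eq: "edge_path b c t = edge_path a b (1 - \<eta> + t)"
        have "edge_path b c t $ a = edge_path a b (1 - \<eta> + t) $ a"
          "edge_path b c t $ c = edge_path a b (1 - \<eta> + t) $ c" by (simp_all add: eq)
        then show False using t(1) \<eta> by (auto simp: edge_path_nth)
      qed
      \<comment> \<open>Through the vertex \<open>b\<close> the distance is at most the sum of
        \<open>2 * t\<close> and twice \<open>\<eta> - t\<close>.\<close>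
      moreover have "dist (edge_path b c t) (edge_path a b (1 - \<eta> + t)) < \<delta>"
        using dist_edge_path[of b c t 0] dist_edge_path[of a b 1 "1 - \<eta> + t"] t \<eta>
          dist_triangle[of "edge_path b c t" "edge_path a b (1 - \<eta> + t)" "vertex_point b"] by simp
      ultimately show "f (edge_path b c t) \<noteq> f (edge_path a b (1 - \<eta> + t))"
        using t \<eta> by (intro \<delta>(2) S) auto
    qed
  qed (use \<delta>(1) in auto)
qed

text \<open>A parametrisation of the cycle agrees with the polygon up to an increasing
  reparametrisation and orientation; the orientation accounts for the two forms of \<open>v\<close>.
  All lags below \<delta> are assumed admissible, since local injectivity of the closed curve
  concerns every small distance.\<close>

lemma rotation_number_cycle:
  fixes f :: "real ^ 'v::finite \<Rightarrow> complex" and vs :: "'v list"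
  assumes \<delta>: "0 < \<delta>" "\<And>\<eta>. 0 < \<eta> \<Longrightarrow> \<eta> < \<delta>
      \<Longrightarrow> immersed_complete_graph (\<lambda>a b t. f (edge_path a b t)) (\<lambda>v. f (vertex_point v)) \<eta>"
    and \<eta>: "0 < \<eta>" "\<eta> < \<delta>"
    and vs: "distinct vs" "3 \<le> length vs" and p: "parametrizes p (cycle_graph vs)"
  obtains v where "v = cyc_nth vs \<or> v = (\<lambda>i. cyc_nth vs (- i))"
    "of_int (rotation_number (f \<circ> p)) = (\<Sum>i<length vs.
        immersed_complete_graph.edge_turn (\<lambda>a b t. f (edge_path a b t)) \<eta> (v (int i)) (v (int i + 1))
      + immersed_complete_graph.corner_turn (\<lambda>a b t. f (edge_path a b t)) \<eta> (v (int i)) (v (int i + 1)) (v (int i + 2)))"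
proof -
  interpret immersed_complete_graph "\<lambda>a b t. f (edge_path a b t)" "\<lambda>v. f (vertex_point v)" \<eta>
    by (rule \<delta>(2)[OF \<eta>])
  let ?k = "real (length vs)"
  have k: "0 < ?k" using vs(2) by linarith
  have p': "simple_path p" "pathfinish p = pathstart p" "path_image p = graph_space (cycle_graph vs)"
    using p by (auto simp: parametrizes_def)
  define q where "q = (\<lambda>t. polygon vs (?k * t))"
  have range_q: "range q = range (polygon vs)"
  proof -
    have "polygon vs t = q (t / ?k)" for t using k by (simp add: q_def)
    then have "range (polygon vs) \<subseteq> range q" by (metis image_subsetI rangeI)
    then show ?thesis by (auto simp: q_def)
  qed
  have cont_q: "continuous_on UNIV q"
    unfolding q_def by (intro continuous_on_compose2[OF continuous_on_polygon[of UNIV]] continuous_intros) auto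
  have q_eq: "q s = q t \<longleftrightarrow> s - t \<in> \<int>" for s t
    using k by (simp add: q_def polygon_eq_iff[OF vs] right_diff_distrib[symmetric])
  note extension = simple_loop_periodic_extension[OF p'(1,2)]
  have "range (\<lambda>t. p (frac t)) = range q"
    using extension(3) p'(3) range_polygon[OF vs] range_q by simp
  then obtain \<theta> where \<theta>: "continuous_on UNIV \<theta>" "strict_mono \<theta>" "\<And>t. \<theta> (t + 1) = \<theta> t + 1"
      "(\<forall>t. p (frac t) = q (\<theta> t)) \<or> (\<forall>t. p (frac t) = q (- \<theta> t))"
    using loop_reparametrization[OF extension(1) cont_q extension(2) q_eq] by blast
  have f_polygon: "f (polygon vs t) = curve (cyc_nth vs) t" for t
    by (simp add: polygon_def curve_def)
  obtain v where v: "v = cyc_nth vs \<or> v = (\<lambda>i. cyc_nth vs (- i))"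
      "\<And>t. (f \<circ> p) (frac t) = curve v (?k * \<theta> t)"
    using \<theta>(4)
  proof
    assume "\<forall>t. p (frac t) = q (\<theta> t)"
    then show thesis by (intro that[of "cyc_nth vs"]) (auto simp: q_def f_polygon)
  next
    assume "\<forall>t. p (frac t) = q (- \<theta> t)"
    then show thesis
      by (intro that[of "\<lambda>i. cyc_nth vs (- i)"]) (auto simp: q_def f_polygon curve_uminus)
  qed
  have v_distinct: "distinct [v i, v (i + 1), v (i + 2)]" for i
    using v(1) cyc_nth_distinct[OF vs, of i] cyc_nth_distinct[OF vs, of "- i - 2"]
    by (auto simp: algebra_simps)
  have v_shift: "v (i + int (length vs)) = v i" for i
    using v(1) cyc_nth_shift[of vs i] cyc_nth_shift[of vs "- i - int (length vs)"] by (auto simp: algebra_simps)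
  interpret C: locally_injective_periodic "curve v" ?k \<delta>
  proof
    show "continuous_on UNIV (curve v)" by (rule continuous_on_curve)
    show "curve v (t + ?k) = curve v t" for t
    proof -
      have "t + ?k = t + of_int (int (length vs))" by simp
      then show ?thesis
        using v_shift[of "\<lfloor>t\<rfloor>"] v_shift[of "\<lfloor>t\<rfloor> + 1"]
        unfolding curve_def frac_def by (simp add: algebra_simps)
    qed
    show "curve v s \<noteq> curve v t" if "s < t" "t < s + \<delta>" for s t
    proof -
      \<comment> \<open>The two points form a secant with lag \<open>t - s\<close>, so the locale is
        instantiated with this lag; the closed curve itself does not depend on the lag.\<close>
      interpret I: immersed_complete_graph "\<lambda>a b t. f (edge_path a b t)" "\<lambda>v. f (vertex_point v)" "t - s"
        using that by (intro \<delta>(2)) auto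
      show ?thesis using I.curve_ne[OF v_distinct, of s] by (simp add: I.curve_def curve_def)
    qed
  qed (rule \<delta>(1))
  have "of_int (rotation_number (f \<circ> p)) = turn (\<lambda>t. curve v (t + \<eta>) - curve v t) 0 ?k"
    by (rule C.rotation_number_eq_turn[where \<theta> = "\<lambda>t. ?k * \<theta> t"])
       (use \<theta> k v(2) \<eta> in \<open>auto intro!: continuous_intros simp: strict_mono_def algebra_simps\<close>)
  also have "\<dots> = (\<Sum>i<length vs. edge_turn (v (int i)) (v (int i + 1))
      + corner_turn (v (int i)) (v (int i + 1)) (v (int i + 2)))"
    by (rule turn_secant[OF v_distinct])
  finally show thesis using that v(1) by blast
qed

lemma rotation_number_triangle:
  fixes f :: "real ^ 'v::finite \<Rightarrow> complex"
  assumes \<delta>: "0 < \<delta>" "\<And>\<eta>. 0 < \<eta> \<Longrightarrow> \<eta> < \<delta>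
      \<Longrightarrow> immersed_complete_graph (\<lambda>a b t. f (edge_path a b t)) (\<lambda>v. f (vertex_point v)) \<eta>"
    and \<eta>: "0 < \<eta>" "\<eta> < \<delta>"
    and abc: "distinct [a, b, c]" and p: "parametrizes p (cycle_graph [a, b, c])"
  shows "odd (rotation_number (f \<circ> p)
    - immersed_complete_graph.triangle_defect (\<lambda>a b t. f (edge_path a b t)) (\<lambda>v. f (vertex_point v)) \<eta> a b c)"
proof -
  interpret immersed_complete_graph "\<lambda>a b t. f (edge_path a b t)" "\<lambda>v. f (vertex_point v)" \<eta>
    by (rule \<delta>(2)[OF \<eta>])
  let ?r = "rotation_number (f \<circ> p)"
  obtain v where v: "v = cyc_nth [a, b, c] \<or> v = (\<lambda>i. cyc_nth [a, b, c] (- i))"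
    "of_int ?r = (\<Sum>i<length [a, b, c]. edge_turn (v (int i)) (v (int i + 1))
      + corner_turn (v (int i)) (v (int i + 1)) (v (int i + 2)))"
    by (rule rotation_number_cycle[OF \<delta> \<eta> abc _ p]) auto
  from v(1) show ?thesis
  proof
    assume "v = cyc_nth [a, b, c]"
    then have "of_int ?r = edge_turn a b + corner_turn a b c + (edge_turn b c + corner_turn b c a)
        + (edge_turn c a + corner_turn c a b)"
      using v(2) by (simp add: cyc_nth_def eval_nat_numeral lessThan_Suc add_ac)
    moreover obtain n where "edge_turn a b + corner_turn a b c + (edge_turn b c + corner_turn b c a)
        + (edge_turn c a + corner_turn c a b) = of_int (triangle_defect a b c + 2 * n + 1)"
      using triangle_turn[OF abc] .
    ultimately have "(of_int ?r :: complex) = of_int (triangle_defect a b c + 2 * n + 1)" by simp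
    then have "?r = triangle_defect a b c + 2 * n + 1" by (simp only: of_int_eq_iff)
    then show ?thesis by simp
  next
    \<comment> \<open>Read backwards from \<open>a\<close>, the triangle is \<open>a\<close>,
      \<open>c\<close>, \<open>b\<close>; its defect has the opposite sign and hence the same
      parity.\<close>
    assume "v = (\<lambda>i. cyc_nth [a, b, c] (- i))"
    then have "of_int ?r = edge_turn a c + corner_turn a c b + (edge_turn c b + corner_turn c b a)
        + (edge_turn b a + corner_turn b a c)"
      using v(2) by (simp add: cyc_nth_def eval_nat_numeral lessThan_Suc add_ac)
    moreover have acb: "distinct [a, c, b]" using abc by auto
    moreover obtain n where "edge_turn a c + corner_turn a c b + (edge_turn c b + corner_turn c b a)
        + (edge_turn b a + corner_turn b a c) = of_int (triangle_defect a c b + 2 * n + 1)"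
      using triangle_turn[OF acb] .
    ultimately have "(of_int ?r :: complex) = of_int (triangle_defect a c b + 2 * n + 1)" by simp
    then have "?r = triangle_defect a c b + 2 * n + 1" by (simp only: of_int_eq_iff)
    moreover have "triangle_defect a c b = - triangle_defect a b c"
      using triangle_defect_rev[of b c a] triangle_defect_cyclic[of b c a] abc by auto
    ultimately show ?thesis by simp
  qed
qed

lemma rotation_number_square:
  fixes f :: "real ^ 'v::finite \<Rightarrow> complex"
  assumes \<delta>: "0 < \<delta>" "\<And>\<eta>. 0 < \<eta> \<Longrightarrow> \<eta> < \<delta>
      \<Longrightarrow> immersed_complete_graph (\<lambda>a b t. f (edge_path a b t)) (\<lambda>v. f (vertex_point v)) \<eta>"
    and \<eta>: "0 < \<eta>" "\<eta> < \<delta>"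
    and abcd: "distinct [a, b, c, d]" and p: "parametrizes p (cycle_graph [a, b, c, d])"
  shows "odd (rotation_number (f \<circ> p)
    - immersed_complete_graph.square_defect (\<lambda>a b t. f (edge_path a b t)) (\<lambda>v. f (vertex_point v)) \<eta> a b c d)"
proof -
  interpret immersed_complete_graph "\<lambda>a b t. f (edge_path a b t)" "\<lambda>v. f (vertex_point v)" \<eta>
    by (rule \<delta>(2)[OF \<eta>])
  let ?r = "rotation_number (f \<circ> p)"
  obtain v where v: "v = cyc_nth [a, b, c, d] \<or> v = (\<lambda>i. cyc_nth [a, b, c, d] (- i))"
    "of_int ?r = (\<Sum>i<length [a, b, c, d]. edge_turn (v (int i)) (v (int i + 1))
      + corner_turn (v (int i)) (v (int i + 1)) (v (int i + 2)))"
    by (rule rotation_number_cycle[OF \<delta> \<eta> abcd _ p]) auto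
  from v(1) show ?thesis
  proof
    assume "v = cyc_nth [a, b, c, d]"
    then have "of_int ?r = edge_turn a b + corner_turn a b c + (edge_turn b c + corner_turn b c d)
        + (edge_turn c d + corner_turn c d a) + (edge_turn d a + corner_turn d a b)"
      using v(2) by (simp add: cyc_nth_def eval_nat_numeral lessThan_Suc add_ac)
    moreover obtain n where "edge_turn a b + corner_turn a b c + (edge_turn b c + corner_turn b c d)
        + (edge_turn c d + corner_turn c d a) + (edge_turn d a + corner_turn d a b)
        = of_int (square_defect a b c d + 2 * n + 1)"
      using square_turn[OF abcd] .
    ultimately have "(of_int ?r :: complex) = of_int (square_defect a b c d + 2 * n + 1)" by simp
    then have "?r = square_defect a b c d + 2 * n + 1" by (simp only: of_int_eq_iff)
    then show ?thesis by simp
  next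
    \<comment> \<open>Read backwards from \<open>a\<close>, the square is \<open>a\<close>,
      \<open>d\<close>, \<open>c\<close>, \<open>b\<close>, the reversal of \<open>b\<close>,
      \<open>c\<close>, \<open>d\<close>, \<open>a\<close>. A reversal and a rotation, both
      preserving the parity of the defect, lead back to the given order.\<close>
    assume "v = (\<lambda>i. cyc_nth [a, b, c, d] (- i))"
    then have "of_int ?r = edge_turn a d + corner_turn a d c + (edge_turn d c + corner_turn d c b)
        + (edge_turn c b + corner_turn c b a) + (edge_turn b a + corner_turn b a d)"
      using v(2) by (simp add: cyc_nth_def eval_nat_numeral lessThan_Suc add_ac)
    moreover have adcb: "distinct [a, d, c, b]" using abcd by auto
    moreover obtain n where "edge_turn a d + corner_turn a d c + (edge_turn d c + corner_turn d c b)
        + (edge_turn c b + corner_turn c b a) + (edge_turn b a + corner_turn b a d)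
        = of_int (square_defect a d c b + 2 * n + 1)"
      using square_turn[OF adcb] .
    ultimately have "(of_int ?r :: complex) = of_int (square_defect a d c b + 2 * n + 1)" by simp
    then have "?r = square_defect a d c b + 2 * n + 1" by (simp only: of_int_eq_iff)
    moreover have "even (square_defect a d c b - square_defect b c d a)"
      using square_defect_rev[of b c d a] abcd by auto
    moreover have "even (square_defect b c d a - square_defect a b c d)"
      using square_defect_cyclic[OF abcd] .
    ultimately show ?thesis by presburger
  qed
qed

theorem corollary1p11:
  fixes f :: "real ^ 'v::finite \<Rightarrow> complex"
    and p :: "'v fin_graph \<Rightarrow> real \<Rightarrow> real ^ 'v"
  assumes "CARD('v) = 4"
    and "plane_generic_immersion complete_graph f"
    and "\<And>\<gamma>. \<gamma> \<in> cycles (complete_graph :: 'v fin_graph) \<Longrightarrow> parametrizes (p \<gamma>) \<gamma>"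
  shows "[(\<Sum>\<gamma>\<in>cycles (complete_graph :: 'v fin_graph). rotation_number (f \<circ> p \<gamma>)) = 1] (mod 2)"
proof -
  have "finite (UNIV :: 'v set)" by simp
  then obtain vs where vs: "set vs = (UNIV :: 'v set)" "distinct vs" using finite_distinct_list by blast
  then have "length vs = 4" using assms(1) distinct_card[of vs] by simp
  then obtain a b c d where "vs = [a, b, c, d]"
    by (auto simp: length_Suc_conv eval_nat_numeral)
  with vs have abcd: "distinct [a, b, c, d]" "UNIV = {a, b, c, d}" by auto
  have "simple_loop_image (graph_space \<gamma>)" if "\<gamma> \<in> cycles (complete_graph :: 'v fin_graph)" for \<gamma>
    using assms(3)[OF that] unfolding simple_loop_image_def parametrizes_def by blast
  then have cycles: "cycles complete_graph = set (map cycle_graph (K4_cycles a b c d))"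
    using cycles_complete_graph_K4[OF abcd] by blast
  define r where "r = (\<lambda>vs. rotation_number (f \<circ> p (cycle_graph vs)))"
  have sum: "(\<Sum>\<gamma>\<in>cycles (complete_graph :: 'v fin_graph). rotation_number (f \<circ> p \<gamma>))
      = sum_list (map r (K4_cycles a b c d))"
    unfolding cycles using distinct_K4_cycles[OF abcd(1)]
    by (subst sum.distinct_set_conv_list) (simp_all add: o_def r_def)
  have p: "parametrizes (p (cycle_graph vs)) (cycle_graph vs)" if "vs \<in> set (K4_cycles a b c d)" for vs
    using assms(3) cycles that by auto
  obtain \<delta> where \<delta>: "0 < \<delta>" "\<And>\<eta>. 0 < \<eta> \<Longrightarrow> \<eta> < \<delta>
      \<Longrightarrow> immersed_complete_graph (\<lambda>a b t. f (edge_path a b t)) (\<lambda>v. f (vertex_point v)) \<eta>"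
    using plane_generic_immersion_immersed_complete_graph[OF assms(2)] by blast
  define \<eta> where "\<eta> = \<delta> / 2"
  have \<eta>: "0 < \<eta>" "\<eta> < \<delta>" using \<delta>(1) by (auto simp: \<eta>_def)
  interpret immersed_complete_graph "\<lambda>a b t. f (edge_path a b t)" "\<lambda>v. f (vertex_point v)" \<eta>
    by (rule \<delta>(2)[OF \<eta>])
  have triangle: "odd (r [x, y, z] - triangle_defect x y z)"
    if "[x, y, z] \<in> set (K4_cycles a b c d)" for x y z
    unfolding r_def using that abcd(1)
    by (intro rotation_number_triangle[OF \<delta> \<eta> _ p]) (auto simp: K4_cycles_def)
  have square: "odd (r [x, y, z, w] - square_defect x y z w)"
    if "[x, y, z, w] \<in> set (K4_cycles a b c d)" for x y z w
    unfolding r_def using that abcd(1)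
    by (intro rotation_number_square[OF \<delta> \<eta> _ p]) (auto simp: K4_cycles_def)
  have "odd (sum_list (map r (K4_cycles a b c d)))"
    using triangle[of a b c] triangle[of a b d] triangle[of a c d] triangle[of b c d]
      square[of a b c d] square[of a b d c] square[of a c b d] even_sum_defects[OF abcd(1)]
    by (simp add: K4_cycles_def) presburger
  then show ?thesis unfolding sum by (simp add: cong_def odd_iff_mod_2_eq_one)
qed

end
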